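(* Let $\Omega$, $K_1,K_2,K_3$, $\mathbf{n}_k$, $\lambda_k$ and $a$ be as in the context, and assume that $\lambda_k$ is pointwise non-negative. If $\kappa=K_2/K_3=1$, then there exists $\alpha_0>0$ such that $$\alpha_0\|\mathbf{v}\|_{DC}^2\le a(\mathbf{v},\mathbf{v})\qquad\text{for all }\mathbf{v}\in\mathcal{H}^{DC}_0(\Omega).$$
   Context: $\Omega$ is an open bounded domain (in $\mathbb{R}^3$, or in $\mathbb{R}^2$ with three-component fields independent of $z$) which is a convex polyhedron or has a $C^{1,1}$ boundary; $\nu$ is the outward unit normal. $(\cdot,\cdot)$, $|\cdot|$ are the Euclidean inner product and norm; $\langle\cdot,\cdot\rangle_0$, $\|\cdot\|_0$ the $L^2$ ones. $\mathcal{H}^{DC}_0(\Omega)=\{\mathbf{v}\in L^2(\Omega)^3:\nabla\cdot\mathbf{v}\in L^2(\Omega),\ \nabla\times\mathbf{v}\in L^2(\Omega)^3,\ \nu\cdot\mathbf{v}=0\text{ and }\nu\times\mathbf{v}=\mathbf{0}\text{ on }\partial\Omega\}$ (Dirichlet boundary conditions), with norm $\|\mathbf{v}\|_{DC}^2=\|\mathbf{v}\|_0^2+\|\nabla\cdot\mathbf{v}\|_0^2+\|\nabla\times\mathbf{v}\|_0^2$. The constants satisfy $K_1\ge0$ and $K_2,K_3>0$. The current iterates are $\lambda_k\in L^2(\Omega)$ and $\mathbf{n}_k\in L^2(\Omega)^3$ with $\nabla\cdot\mathbf{n}_k\in L^2(\Omega)$, $\nabla\times\mathbf{n}_k\in L^2(\Omega)^3$,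 and $\alpha\le|\mathbf{n}_k|^2\le\beta$ on $\Omega$ for constants $0<\alpha\le1\le\beta$, such that $\mathbf{Z}(\mathbf{n}_k)=\mathbf{I}-(1-\kappa)\mathbf{n}_k\otimes\mathbf{n}_k$ is uniformly symmetric positive definite (its quadratic form lies between $\eta|\xi|^2$ and $\Lambda|\xi|^2$, $0<\eta\le\Lambda$, uniformly on $\Omega$). The bilinear form is $a(\mathbf{u},\mathbf{v})=K_1\langle\nabla\cdot\mathbf{u},\nabla\cdot\mathbf{v}\rangle_0+K_3\langle\mathbf{Z}(\mathbf{n}_k)\nabla\times\mathbf{u},\nabla\times\mathbf{v}\rangle_0+(K_2-K_3)\big(\langle\mathbf{u}\cdot\nabla\times\mathbf{v},\mathbf{n}_k\cdot\nabla\times\mathbf{n}_k\rangle_0+\langle\mathbf{n}_k\cdot\nabla\times\mathbf{v},\mathbf{u}\cdot\nabla\times\mathbf{n}_k\rangle_0+\langle\mathbf{n}_k\cdot\nabla\times\mathbf{n}_k,\mathbf{v}\cdot\nabla\times\mathbf{u}\rangle_0+\langle\mathbf{n}_k\cdot\nabla\times\mathbf{u},\mathbf{v}\cdot\nabla\times\mathbf{n}_k\rangle_0+\langle\mathbf{u}\cdot\nabla\times\mathbf{n}_k,\mathbf{v}\cdot\nabla\times\mathbf{n}_k\rangle_0\big)+\int_\Omega\lambda_k(\mathbf{u},\mathbf{v})\,dV$ (for $\kappa=1$ the $(K_2-K_3)$ group is absent, being multiplied by zero).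
   Formalization: The formal theorem assumes K_1 > 0 rather than K_1 ≥ 0; for K_1 = 0 the claim is false, e.g. λ_k = 0, n_k a constant unit vector and v = ∇φ with nonzero φ in C_c^∞(Ω), where a(v,v) = 0 but ‖v‖_DC > 0. *)

theory Defs
  imports "HOL-Analysis.Analysis"
begin

text \<open>
  The domain lives in a Euclidean space \<open>'a\<close>, while all fields take values in \<open>real^3\<close>. A linear
  map \<open>P :: real^3 \<Rightarrow> 'a\<close> records how physical space is projected onto the space of independent
  variables: \<open>P = id\<close> for three-dimensional domains, and \<open>P = drop_z\<close> for planar domains with
  three-component fields that do not depend on \<open>z\<close>. A field \<open>f\<close> on \<open>'a\<close> stands for \<open>f \<circ> P\<close> on
  \<open>real^3\<close>, whose derivative along the \<open>i\<close>-th axis is the derivative of \<open>f\<close> along \<open>P (axis i 1)\<close>.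
  In the planar case \<open>P (axis 3 1) = 0\<close>, so that derivatives in \<open>z\<close> vanish.
\<close>

definition drop_z :: "real^3 \<Rightarrow> real^2" where
  "drop_z x = vector [x $ 1, x $ 2]"

subsection \<open>Domains\<close>

text \<open>
  \<open>C\<^sup>1\<^sup>,\<^sup>1\<close> boundary: near each boundary point, in suitable orthonormal coordinates, the domain lies
  strictly on one side of the graph of a function with Lipschitz gradient. Here \<open>e\<close> is the vertical
  direction of the coordinates and \<open>x - (x \<bullet> e) *\<^sub>R e\<close> is the horizontal part of \<open>x\<close>. Asking for \<open>g\<close> to
  be defined globally is no restriction, by a cutoff and a smaller radius.
\<close>

definition C11_boundary :: "'a::euclidean_space set \<Rightarrow> bool" where
  "C11_boundary \<Omega> \<longleftrightarrow>
     (\<forall>p\<in>frontier \<Omega>. \<exists>e r g g' L.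
        norm e = 1 \<and> r > 0 \<and>
        (\<forall>y. GDERIV g y :> g' y) \<and> L-lipschitz_on UNIV g' \<and>
        \<Omega> \<inter> ball p r = {x \<in> ball p r. x \<bullet> e < g (x - (x \<bullet> e) *\<^sub>R e)})"

definition admissible_domain :: "'a::euclidean_space set \<Rightarrow> bool" where
  "admissible_domain \<Omega> \<longleftrightarrow>
     open \<Omega> \<and> bounded \<Omega> \<and> connected \<Omega> \<and> \<Omega> \<noteq> {} \<and>
     ((convex \<Omega> \<and> polyhedron (closure \<Omega>)) \<or> C11_boundary \<Omega>)"

subsection \<open>Square-integrable functions\<close>

text \<open>Functions rather than classes modulo null sets; all notions below are insensitive to
  modification on a null set.\<close>

definition L2 :: "'a::euclidean_space set \<Rightarrow> ('a \<Rightarrow> 'b::euclidean_space) set" where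
  "L2 \<Omega> = {f. f \<in> borel_measurable (lebesgue_on \<Omega>) \<and>
              integrable (lebesgue_on \<Omega>) (\<lambda>x. (norm (f x))\<^sup>2)}"

definition L2_inner ::
    "'a::euclidean_space set \<Rightarrow> ('a \<Rightarrow> 'b::euclidean_space) \<Rightarrow> ('a \<Rightarrow> 'b) \<Rightarrow> real" where
  "L2_inner \<Omega> f g = (LINT x|lebesgue_on \<Omega>. f x \<bullet> g x)"

definition L2_norm :: "'a::euclidean_space set \<Rightarrow> ('a \<Rightarrow> 'b::euclidean_space) \<Rightarrow> real" where
  "L2_norm \<Omega> f = sqrt (L2_inner \<Omega> f f)"

subsection \<open>Test functions\<close>

fun Ck :: "nat \<Rightarrow> ('a::euclidean_space \<Rightarrow> real) \<Rightarrow> bool" where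
  "Ck 0 f \<longleftrightarrow> continuous_on UNIV f"
| "Ck (Suc k) f \<longleftrightarrow>
     (\<forall>x. f differentiable (at x)) \<and>
     (\<forall>b\<in>Basis. Ck k (\<lambda>x. frechet_derivative f (at x) b))"

definition test_functions :: "'a::euclidean_space set \<Rightarrow> ('a \<Rightarrow> real) set" where
  "test_functions \<Omega> =
     {\<phi>. (\<forall>k. Ck k \<phi>) \<and> compact (closure {x. \<phi> x \<noteq> 0}) \<and> closure {x. \<phi> x \<noteq> 0} \<subseteq> \<Omega>}"

definition test_fields :: "'a::euclidean_space set \<Rightarrow> ('a \<Rightarrow> real^3) set" where
  "test_fields \<Omega> = {\<psi>. \<forall>i. (\<lambda>x. \<psi> x $ i) \<in> test_functions \<Omega>}"

definition pderiv_axis ::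
    "(real^3 \<Rightarrow> 'a::euclidean_space) \<Rightarrow> 3 \<Rightarrow> ('a \<Rightarrow> real) \<Rightarrow> 'a \<Rightarrow> real" where
  "pderiv_axis P i \<phi> x = frechet_derivative \<phi> (at x) (P (axis i 1))"

definition grad ::
    "(real^3 \<Rightarrow> 'a::euclidean_space) \<Rightarrow> ('a \<Rightarrow> real) \<Rightarrow> 'a \<Rightarrow> real^3" where
  "grad P \<phi> x = (\<chi> i. pderiv_axis P i \<phi> x)"

definition curl ::
    "(real^3 \<Rightarrow> 'a::euclidean_space) \<Rightarrow> ('a \<Rightarrow> real^3) \<Rightarrow> 'a \<Rightarrow> real^3" where
  "curl P \<psi> x =
     vector [pderiv_axis P 2 (\<lambda>y. \<psi> y $ 3) x - pderiv_axis P 3 (\<lambda>y. \<psi> y $ 2) x,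
             pderiv_axis P 3 (\<lambda>y. \<psi> y $ 1) x - pderiv_axis P 1 (\<lambda>y. \<psi> y $ 3) x,
             pderiv_axis P 1 (\<lambda>y. \<psi> y $ 2) x - pderiv_axis P 2 (\<lambda>y. \<psi> y $ 1) x]"

subsection \<open>Weak derivatives\<close>

definition has_weak_grad ::
    "(real^3 \<Rightarrow> 'a::euclidean_space) \<Rightarrow> 'a set \<Rightarrow> ('a \<Rightarrow> real) \<Rightarrow> ('a \<Rightarrow> real^3) \<Rightarrow> bool" where
  "has_weak_grad P \<Omega> f g \<longleftrightarrow>
     g \<in> L2 \<Omega> \<and>
     (\<forall>\<phi>\<in>test_functions \<Omega>. \<forall>i.
        L2_inner \<Omega> f (pderiv_axis P i \<phi>) = - L2_inner \<Omega> (\<lambda>x. g x $ i) \<phi>)"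

definition has_weak_div ::
    "(real^3 \<Rightarrow> 'a::euclidean_space) \<Rightarrow> 'a set \<Rightarrow> ('a \<Rightarrow> real^3) \<Rightarrow> ('a \<Rightarrow> real) \<Rightarrow> bool" where
  "has_weak_div P \<Omega> v d \<longleftrightarrow>
     d \<in> L2 \<Omega> \<and>
     (\<forall>\<phi>\<in>test_functions \<Omega>. L2_inner \<Omega> v (grad P \<phi>) = - L2_inner \<Omega> d \<phi>)"

definition has_weak_curl ::
    "(real^3 \<Rightarrow> 'a::euclidean_space) \<Rightarrow> 'a set \<Rightarrow> ('a \<Rightarrow> real^3) \<Rightarrow> ('a \<Rightarrow> real^3) \<Rightarrow> bool" where
  "has_weak_curl P \<Omega> v c \<longleftrightarrow>
     c \<in> L2 \<Omega> \<and>
     (\<forall>\<psi>\<in>test_fields \<Omega>. L2_inner \<Omega> v (curl P \<psi>) = L2_inner \<Omega> c \<psi>)"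

text \<open>Weak derivatives are unique up to null sets, so the choices below do not affect any integral.\<close>

definition weak_grad ::
    "(real^3 \<Rightarrow> 'a::euclidean_space) \<Rightarrow> 'a set \<Rightarrow> ('a \<Rightarrow> real) \<Rightarrow> 'a \<Rightarrow> real^3" where
  "weak_grad P \<Omega> f = (SOME g. has_weak_grad P \<Omega> f g)"

definition weak_div ::
    "(real^3 \<Rightarrow> 'a::euclidean_space) \<Rightarrow> 'a set \<Rightarrow> ('a \<Rightarrow> real^3) \<Rightarrow> 'a \<Rightarrow> real" where
  "weak_div P \<Omega> v = (SOME d. has_weak_div P \<Omega> v d)"

definition weak_curl ::
    "(real^3 \<Rightarrow> 'a::euclidean_space) \<Rightarrow> 'a set \<Rightarrow> ('a \<Rightarrow> real^3) \<Rightarrow> 'a \<Rightarrow> real^3" where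
  "weak_curl P \<Omega> v = (SOME c. has_weak_curl P \<Omega> v c)"

definition H1 :: "(real^3 \<Rightarrow> 'a::euclidean_space) \<Rightarrow> 'a set \<Rightarrow> ('a \<Rightarrow> real) set" where
  "H1 P \<Omega> = {f \<in> L2 \<Omega>. \<exists>g. has_weak_grad P \<Omega> f g}"

definition H1_fields :: "(real^3 \<Rightarrow> 'a::euclidean_space) \<Rightarrow> 'a set \<Rightarrow> ('a \<Rightarrow> real^3) set" where
  "H1_fields P \<Omega> = {\<psi>. \<forall>i. (\<lambda>x. \<psi> x $ i) \<in> H1 P \<Omega>}"

subsection \<open>The space H-DC and its boundary conditions\<close>

definition HDC :: "(real^3 \<Rightarrow> 'a::euclidean_space) \<Rightarrow> 'a set \<Rightarrow> ('a \<Rightarrow> real^3) set" where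
  "HDC P \<Omega> = {v \<in> L2 \<Omega>. (\<exists>d. has_weak_div P \<Omega> v d) \<and> (\<exists>c. has_weak_curl P \<Omega> v c)}"

text \<open>
  Fields in \<open>HDC\<close> have no pointwise boundary values. As usual, \<open>\<nu> \<cdot> v\<close> and \<open>\<nu> \<times> v\<close> on the boundary
  are the elements of \<open>H\<^sup>-\<^sup>1\<^sup>/\<^sup>2\<close>, the dual of the traces of \<open>H\<^sup>1\<close>, given by Green's formulas
  \<open>\<langle>\<nu> \<cdot> v, \<phi>\<rangle> = \<integral> v \<cdot> \<nabla>\<phi> + (\<nabla> \<cdot> v) \<phi>\<close> and \<open>\<langle>\<nu> \<times> v, \<psi>\<rangle> = \<integral> (\<nabla> \<times> v) \<cdot> \<psi> - v \<cdot> (\<nabla> \<times> \<psi>)\<close>.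
  For smooth \<open>v\<close> these are the boundary integrals of \<open>(\<nu> \<cdot> v) \<phi>\<close> and \<open>(\<nu> \<times> v) \<cdot> \<psi>\<close>.
\<close>

definition normal_trace ::
    "(real^3 \<Rightarrow> 'a::euclidean_space) \<Rightarrow> 'a set \<Rightarrow> ('a \<Rightarrow> real^3) \<Rightarrow> ('a \<Rightarrow> real) \<Rightarrow> real" where
  "normal_trace P \<Omega> v \<phi> = L2_inner \<Omega> v (weak_grad P \<Omega> \<phi>) + L2_inner \<Omega> (weak_div P \<Omega> v) \<phi>"

definition tangential_trace ::
    "(real^3 \<Rightarrow> 'a::euclidean_space) \<Rightarrow> 'a set \<Rightarrow> ('a \<Rightarrow> real^3) \<Rightarrow> ('a \<Rightarrow> real^3) \<Rightarrow> real" where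
  "tangential_trace P \<Omega> v \<psi> =
     L2_inner \<Omega> (weak_curl P \<Omega> v) \<psi> - L2_inner \<Omega> v (weak_curl P \<Omega> \<psi>)"

definition HDC0 :: "(real^3 \<Rightarrow> 'a::euclidean_space) \<Rightarrow> 'a set \<Rightarrow> ('a \<Rightarrow> real^3) set" where
  "HDC0 P \<Omega> = {v \<in> HDC P \<Omega>.
     (\<forall>\<phi>\<in>H1 P \<Omega>. normal_trace P \<Omega> v \<phi> = 0) \<and>
     (\<forall>\<psi>\<in>H1_fields P \<Omega>. tangential_trace P \<Omega> v \<psi> = 0)}"

definition norm_DC ::
    "(real^3 \<Rightarrow> 'a::euclidean_space) \<Rightarrow> 'a set \<Rightarrow> ('a \<Rightarrow> real^3) \<Rightarrow> real" where
  "norm_DC P \<Omega> v =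
     sqrt ((L2_norm \<Omega> v)\<^sup>2 + (L2_norm \<Omega> (weak_div P \<Omega> v))\<^sup>2 + (L2_norm \<Omega> (weak_curl P \<Omega> v))\<^sup>2)"

subsection \<open>The linearised Frank-Oseen form\<close>

definition Zmat :: "real \<Rightarrow> real^3 \<Rightarrow> real^3^3" where
  "Zmat \<kappa> n = mat 1 - (1 - \<kappa>) *\<^sub>R (\<chi> i j. n $ i * n $ j)"

text \<open>
  For \<open>K1 = 0\<close> the form does not control the divergence, and it is not coercive in \<open>norm_DC\<close> whatever
  the other data: test with gradients of functions concentrated near a point. Coercivity is
  therefore a statement about \<open>K1 > 0\<close>.
\<close>

definition frank_form ::
    "(real^3 \<Rightarrow> 'a::euclidean_space) \<Rightarrow> 'a set \<Rightarrow> real \<Rightarrow> real \<Rightarrow> real \<Rightarrow>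
     ('a \<Rightarrow> real^3) \<Rightarrow> ('a \<Rightarrow> real) \<Rightarrow> ('a \<Rightarrow> real^3) \<Rightarrow> ('a \<Rightarrow> real^3) \<Rightarrow> real" where
  "frank_form P \<Omega> K1 K2 K3 n lam u v =
     (let \<kappa> = K2 / K3; cu = weak_curl P \<Omega> u; cv = weak_curl P \<Omega> v; cn = weak_curl P \<Omega> n in
        K1 * L2_inner \<Omega> (weak_div P \<Omega> u) (weak_div P \<Omega> v)
      + K3 * L2_inner \<Omega> (\<lambda>x. Zmat \<kappa> (n x) *v cu x) cv
      + (K2 - K3) *
          ( L2_inner \<Omega> (\<lambda>x. u x \<bullet> cv x) (\<lambda>x. n x \<bullet> cn x)
          + L2_inner \<Omega> (\<lambda>x. n x \<bullet> cv x) (\<lambda>x. u x \<bullet> cn x)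
          + L2_inner \<Omega> (\<lambda>x. n x \<bullet> cn x) (\<lambda>x. v x \<bullet> cu x)
          + L2_inner \<Omega> (\<lambda>x. n x \<bullet> cu x) (\<lambda>x. v x \<bullet> cn x)
          + L2_inner \<Omega> (\<lambda>x. u x \<bullet> cn x) (\<lambda>x. v x \<bullet> cn x))
      + (LINT x|lebesgue_on \<Omega>. lam x * (u x \<bullet> v x)))"

text \<open>The standing assumptions on the current iterate, for \<open>\<kappa> = K2 / K3\<close>.\<close>

definition admissible_iterate ::
    "(real^3 \<Rightarrow> 'a::euclidean_space) \<Rightarrow> 'a set \<Rightarrow> real \<Rightarrow> real \<Rightarrow> real \<Rightarrow> real \<Rightarrow> real \<Rightarrow>
     ('a \<Rightarrow> real^3) \<Rightarrow> ('a \<Rightarrow> real) \<Rightarrow> bool" where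
  "admissible_iterate P \<Omega> \<kappa> \<alpha> \<beta> \<eta> \<Lambda> n lam \<longleftrightarrow>
     lam \<in> L2 \<Omega> \<and> n \<in> HDC P \<Omega> \<and>
     (AE x in lebesgue_on \<Omega>. \<alpha> \<le> (norm (n x))\<^sup>2 \<and> (norm (n x))\<^sup>2 \<le> \<beta>) \<and>
     (AE x in lebesgue_on \<Omega>. \<forall>\<xi>.
        \<eta> * (norm \<xi>)\<^sup>2 \<le> \<xi> \<bullet> (Zmat \<kappa> (n x) *v \<xi>) \<and>
        \<xi> \<bullet> (Zmat \<kappa> (n x) *v \<xi>) \<le> \<Lambda> * (norm \<xi>)\<^sup>2)"

end

theory Submission
  imports Defs
begin

text \<open>
  For \<open>K2 = K3\<close> the matrix \<open>Zmat\<close> is the identity and the terms with factor \<open>K2 - K3\<close> vanish, and the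
  term with \<open>lam\<close> is non-negative. So the form dominates the squared norms of the divergence and of
  the curl, and coercivity amounts to the inequality of Poincare-Friedrichs type
  \<open>\<parallel>v\<parallel>\<^sup>2 \<le> C (\<parallel>div v\<parallel>\<^sup>2 + \<parallel>curl v\<parallel>\<^sup>2)\<close> for fields whose normal and tangential traces both vanish
  (lemma \<open>HDC0_poincare\<close>).

  That inequality is a computation with Fourier series. Since both traces vanish, Green's formulas
  hold for \<open>v\<close> against every smooth function on the whole space, in particular against plane waves:
  there are no boundary terms, as if \<open>v\<close> extended by zero had a divergence and a curl on the whole
  space. On the level of Fourier coefficients the divergence becomes \<open>k \<bullet> v\<^sub>k\<close> and the curl becomes
  \<open>k \<times> v\<^sub>k\<close> (up to a factor \<open>\<i>\<close>), and Lagrange's identity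
  \<open>(k \<bullet> v\<^sub>k)\<^sup>2 + (norm (k \<times> v\<^sub>k))\<^sup>2 = (norm k)\<^sup>2 (norm v\<^sub>k)\<^sup>2\<close> gives an exact balance for each \<open>k\<close> (lemma
  \<open>HDC0_wave_energy_balance\<close>). Put the domain in a cube of side \<open>2 \<pi> R\<close>. The plane waves whose frequencies
  have all coordinates in \<open>(\<int> + 1/2) / R\<close> form a complete orthogonal system on the cube, as the usual
  system does, because the two differ by one fixed factor of modulus one. The shift by one half removes
  the frequency \<open>0\<close>: all these frequencies have norm at least \<open>1 / (2 R)\<close>. Summing the balance over
  \<open>k\<close>, with completeness (lemma \<open>wave_energy_complete\<close>) for \<open>v\<close> and Bessel's inequality (lemma
  \<open>wave_bessel\<close>) for its divergence and curl, gives the inequality with \<open>C = (2 R)\<^sup>2\<close>.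

  Two supporting facts are needed. Traces are defined through chosen weak derivatives of
  the test function, so the classical derivatives of a plane wave have to be identified with these; this
  uses the fundamental lemma of the calculus of variations (\<open>L2_eq_0_if_orthogonal_to_test_functions\<close>).
  And completeness of the plane waves comes from the Stone-Weierstrass theorem on the torus
  (\<open>trig_poly_uniformly_dense\<close>).

  Both kinds of domains are treated at once. All that matters about the map \<open>P\<close> is that its adjoint,
  which sends a frequency \<open>k\<close> to the vector with components \<open>k \<bullet> P (axis i 1)\<close>, is isometric.
\<close>

section \<open>Square-integrable functions\<close>

lemma L2_integrable:
  assumes "f \<in> L2 \<Omega>" "bounded \<Omega>" "\<Omega> \<in> sets lebesgue"
  shows "integrable (lebesgue_on \<Omega>) f"
proof -
  interpret finite_measure "lebesgue_on \<Omega>"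
    using assms by (intro finite_measure_lebesgue_on) (simp add: bounded_set_imp_lmeasurable)
  show ?thesis
  proof (rule Bochner_Integration.integrable_bound)
    show "integrable (lebesgue_on \<Omega>) (\<lambda>x. (norm (f x))\<^sup>2 + 1)"
      using assms by (auto simp: L2_def)
    have "norm (f x) \<le> (norm (f x))\<^sup>2 + 1" for x
      using sum_squares_bound[of "norm (f x)" 1] norm_ge_zero[of "f x"]
      unfolding power_one mult_1_right by linarith
    then show "AE x in lebesgue_on \<Omega>. norm (f x) \<le> norm ((norm (f x))\<^sup>2 + 1)"
      by (auto intro!: AE_I2 intro: order_trans[OF _ abs_ge_self])
  qed (use assms in \<open>auto simp: L2_def\<close>)
qed

lemma L2_of_continuous:
  fixes f :: "'a::euclidean_space \<Rightarrow> 'b::euclidean_space"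
  assumes "open \<Omega>" "bounded \<Omega>" "continuous_on UNIV f"
  shows "f \<in> L2 \<Omega>"
proof -
  have S: "\<Omega> \<in> sets lebesgue" using assms by simp
  interpret finite_measure "lebesgue_on \<Omega>"
    using assms S by (intro finite_measure_lebesgue_on) (simp add: bounded_set_imp_lmeasurable)
  have m: "f \<in> borel_measurable (lebesgue_on \<Omega>)"
    using S assms by (intro continuous_imp_measurable_on_sets_lebesgue) (auto intro: continuous_on_subset)
  have "compact (f ` closure \<Omega>)"
    using assms by (intro compact_continuous_image) (auto intro: continuous_on_subset)
  then obtain M where M: "\<And>x. x \<in> \<Omega> \<Longrightarrow> norm (f x) \<le> M"
    using closure_subset unfolding bounded_iff compact_eq_bounded_closed by blast
  have "integrable (lebesgue_on \<Omega>) (\<lambda>x. (norm (f x))\<^sup>2)"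
    by (rule integrable_const_bound[where B = "M\<^sup>2"])
      (use m M in \<open>auto intro!: AE_I2 power_mono\<close>)
  then show ?thesis using m by (simp add: L2_def)
qed

lemma L2_inner_integrable:
  assumes "f \<in> L2 \<Omega>" "g \<in> L2 \<Omega>"
  shows "integrable (lebesgue_on \<Omega>) (\<lambda>x. f x \<bullet> g x)"
proof (rule Bochner_Integration.integrable_bound)
  show "integrable (lebesgue_on \<Omega>) (\<lambda>x. (norm (f x))\<^sup>2 + (norm (g x))\<^sup>2)"
    using assms by (auto simp: L2_def)
  have "\<bar>f x \<bullet> g x\<bar> \<le> (norm (f x))\<^sup>2 + (norm (g x))\<^sup>2" for x
  proof -
    have "2 * (norm (f x) * norm (g x)) \<le> (norm (f x))\<^sup>2 + (norm (g x))\<^sup>2"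
      using sum_squares_bound[of "norm (f x)" "norm (g x)"] by (simp add: mult.assoc)
    moreover have "0 \<le> norm (f x) * norm (g x)" by simp
    ultimately show ?thesis using Cauchy_Schwarz_ineq2[of "f x" "g x"] by linarith
  qed
  then show "AE x in lebesgue_on \<Omega>. norm (f x \<bullet> g x) \<le> norm ((norm (f x))\<^sup>2 + (norm (g x))\<^sup>2)"
    by (auto intro!: AE_I2)
qed (use assms in \<open>auto simp: L2_def\<close>)

lemma L2_add:
  assumes "f \<in> L2 \<Omega>" "g \<in> L2 \<Omega>"
  shows "(\<lambda>x. f x + g x) \<in> L2 \<Omega>"
proof -
  have "integrable (lebesgue_on \<Omega>) (\<lambda>x. (norm (f x))\<^sup>2 + (norm (g x))\<^sup>2 + 2 * (f x \<bullet> g x))"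
    using L2_inner_integrable[OF assms] assms by (auto simp: L2_def)
  then show ?thesis
    using assms by (auto simp: L2_def power2_norm_eq_inner inner_simps inner_commute algebra_simps)
qed

lemma L2_uminus: "f \<in> L2 \<Omega> \<Longrightarrow> (\<lambda>x. - f x) \<in> L2 \<Omega>"
  by (auto simp: L2_def)

lemma L2_diff: "f \<in> L2 \<Omega> \<Longrightarrow> g \<in> L2 \<Omega> \<Longrightarrow> (\<lambda>x. f x - g x) \<in> L2 \<Omega>"
  using L2_add[of f \<Omega> "\<lambda>x. - g x"] L2_uminus[of g \<Omega>] by simp

lemma L2_component:
  fixes f :: "'a::euclidean_space \<Rightarrow> real^'n"
  assumes "f \<in> L2 \<Omega>" shows "(\<lambda>x. f x $ i) \<in> L2 \<Omega>"
proof -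
  have m: "(\<lambda>x. f x $ i) \<in> borel_measurable (lebesgue_on \<Omega>)"
    using assms by (auto simp: L2_def cart_eq_inner_axis intro!: borel_measurable_inner)
  have "integrable (lebesgue_on \<Omega>) (\<lambda>x. (norm (f x $ i))\<^sup>2)"
    by (rule Bochner_Integration.integrable_bound[where f = "\<lambda>x. (norm (f x))\<^sup>2"])
      (use assms m in \<open>auto simp: L2_def abs_le_square_iff[symmetric] intro!: AE_I2 component_le_norm_cart\<close>)
  then show ?thesis using m by (simp add: L2_def)
qed

section \<open>Smooth bumps and the fundamental lemma of the calculus of variations\<close>

text \<open>
  The classical function that is smooth but not analytic at \<open>0\<close>, divided by powers of \<open>t\<close>: with these
  powers the family is closed under differentiation up to linear combinations, which makes smoothness
  an induction over the order.
\<close>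

definition flat_exp :: "nat \<Rightarrow> real \<Rightarrow> real" where
  "flat_exp m t = (if t > 0 then exp (- (1 / t)) / t ^ m else 0)"

lemma flat_exp_tendsto_0: "(flat_exp m \<longlongrightarrow> 0) (at 0)"
proof -
  have "(((\<lambda>x::real. x ^ m / exp x) \<circ> inverse) \<longlongrightarrow> 0) (at_right 0)"
    unfolding comp_def
    by (rule filterlim_compose[OF tendsto_power_div_exp_0 filterlim_inverse_at_top_right])
  moreover have "eventually (\<lambda>t::real. t > 0) (at_right 0)"
    by (simp add: eventually_at_filter)
  ultimately have r: "(flat_exp m \<longlongrightarrow> 0) (at_right 0)"
    by (elim Lim_transform_eventually)
      (auto elim!: eventually_mono simp: flat_exp_def exp_minus field_simps)
  have l: "(flat_exp m \<longlongrightarrow> 0) (at_left 0)"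
    by (rule tendsto_eventually) (auto simp: eventually_at_filter flat_exp_def)
  show ?thesis using l r by (simp add: filterlim_split_at)
qed

lemma flat_exp_has_derivative:
  "(flat_exp m has_real_derivative (- real m * flat_exp (Suc m) t + flat_exp (m + 2) t)) (at t)"
proof -
  consider "t > 0" | "t = 0" | "t < 0" by linarith
  then show ?thesis
  proof cases
    case 1
    have "((\<lambda>t. exp (- (1 / t)) / t ^ m) has_real_derivative
            (- real m * flat_exp (Suc m) t + flat_exp (m + 2) t)) (at t)"
      using 1
      apply (auto intro!: derivative_eq_intros simp: flat_exp_def)
      apply (cases m)
       apply (auto simp: field_simps power2_eq_square power_add)
      done
    then show ?thesis
      by (rule has_field_derivative_transform_within_open[where S = "{0<..}"])
        (use 1 in \<open>auto simp: flat_exp_def\<close>)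
  next
    case 2
    have "((\<lambda>y. (flat_exp m y - flat_exp m 0) / (y - 0)) \<longlongrightarrow> 0) (at 0)"
      by (rule Lim_transform_eventually[OF flat_exp_tendsto_0[of "Suc m"]])
        (auto simp: flat_exp_def eventually_at_filter)
    then show ?thesis unfolding 2 has_field_derivative_iff
      by (simp add: flat_exp_def)
  next
    case 3
    have "((\<lambda>t. 0) has_real_derivative
            (- real m * flat_exp (Suc m) t + flat_exp (m + 2) t)) (at t)"
      using 3 by (simp add: flat_exp_def)
    then show ?thesis
      by (rule has_field_derivative_transform_within_open[where S = "{..<0}"])
        (use 3 in \<open>auto simp: flat_exp_def\<close>)
  qed
qed

lemma Ck_SucI:
  assumes "\<And>x. (f has_derivative D x) (at x)" "\<And>b. b \<in> Basis \<Longrightarrow> Ck k (\<lambda>x. D x b)"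
  shows "Ck (Suc k) f"
proof -
  have "frechet_derivative f (at x) = D x" for x
    using assms(1) by (rule frechet_derivative_at[symmetric])
  then show ?thesis using assms by (auto simp: differentiable_def)
qed

lemma Ck_SucD:
  assumes "Ck (Suc k) f"
  shows "(f has_derivative frechet_derivative f (at x)) (at x)"
    and "b \<in> Basis \<Longrightarrow> Ck k (\<lambda>x. frechet_derivative f (at x) b)"
  using assms by (auto simp: frechet_derivative_works)

lemma Ck_Suc_imp_Ck: "Ck (Suc k) f \<Longrightarrow> Ck k f"
proof (induction k arbitrary: f)
  case 0
  then have "f differentiable_on UNIV" by (auto simp: differentiable_on_def)
  then show ?case by (simp add: differentiable_imp_continuous_on)
next
  case (Suc k)
  then show ?case by (metis Ck.simps(2))
qed

lemma Ck_const: "Ck k (\<lambda>x. c)"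
proof (induction k arbitrary: c)
  case (Suc k)
  show ?case by (rule Ck_SucI[where D = "\<lambda>x h. 0"]) (auto intro: Suc)
qed auto

lemma Ck_add: "Ck k f \<Longrightarrow> Ck k g \<Longrightarrow> Ck k (\<lambda>x. f x + g x)"
proof (induction k arbitrary: f g)
  case (Suc k)
  show ?case
    by (rule Ck_SucI[OF has_derivative_add]) (use Suc Ck_SucD in blast)+
qed (auto intro!: continuous_on_add continuous_on_mult)

lemma Ck_mult: "Ck k f \<Longrightarrow> Ck k g \<Longrightarrow> Ck k (\<lambda>x. f x * g x)"
proof (induction k arbitrary: f g)
  case (Suc k)
  show ?case
  proof (rule Ck_SucI[OF has_derivative_mult])
    show "(f has_derivative frechet_derivative f (at x)) (at x)"
      "(g has_derivative frechet_derivative g (at x)) (at x)" for x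
      using Suc.prems Ck_SucD by blast+
    show "Ck k (\<lambda>x. f x * frechet_derivative g (at x) b + frechet_derivative f (at x) b * g x)"
      if "b \<in> Basis" for b
      using that Suc.prems
      by (intro Ck_add Suc.IH Ck_SucD(2)[where b = b] Ck_Suc_imp_Ck[of k f] Ck_Suc_imp_Ck[of k g])
  qed
qed (auto intro!: continuous_on_add continuous_on_mult)

lemma Ck_prod: "(\<And>i. i \<in> I \<Longrightarrow> Ck k (f i)) \<Longrightarrow> Ck k (\<lambda>x. \<Prod>i\<in>I. f i x)"
  by (induction I rule: infinite_finite_induct) (auto intro: Ck_const Ck_mult)

text \<open>
  The order of differentiability decreases while the power \<open>m\<close> increases, hence the induction for all
  \<open>m\<close> at once.
\<close>

lemma Ck_flat_exp: "Ck k (\<lambda>x. flat_exp m (x \<bullet> u + d))"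
proof (induction k arbitrary: m)
  case 0
  have "flat_exp m differentiable_on UNIV"
    using flat_exp_has_derivative
    by (auto simp: differentiable_on_def real_differentiable_def)
  then have "continuous_on UNIV (flat_exp m)"
    by (rule differentiable_imp_continuous_on)
  then show ?case
    by (auto intro!: continuous_intros continuous_on_compose2[where f = "\<lambda>x. x \<bullet> u + d"] simp del: continuous_on_id)
next
  case (Suc k)
  show ?case
  proof (rule Ck_SucI)
    show "((\<lambda>x. flat_exp m (x \<bullet> u + d)) has_derivative
        (\<lambda>h. (- real m * flat_exp (Suc m) (x \<bullet> u + d) + flat_exp (m + 2) (x \<bullet> u + d)) * (h \<bullet> u)))
        (at x)" for x
      by (rule DERIV_compose_FDERIV[OF flat_exp_has_derivative, THEN has_derivative_eq_rhs])
        (auto intro!: derivative_eq_intros)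
    show "Ck k (\<lambda>x. (- real m * flat_exp (Suc m) (x \<bullet> u + d) + flat_exp (m + 2) (x \<bullet> u + d)) * (b \<bullet> u))"
      for b
      by (intro Ck_mult Ck_add Ck_const Suc)
  qed
qed

text \<open>
  As \<open>n\<close> grows these smooth functions increase to the indicator of the open box.
\<close>

definition box_bump :: "'a::euclidean_space \<Rightarrow> 'a \<Rightarrow> nat \<Rightarrow> 'a \<Rightarrow> real" where
  "box_bump a b n x =
     (\<Prod>i\<in>Basis. flat_exp 0 (real (Suc n) * (x \<bullet> i - a \<bullet> i)) * flat_exp 0 (real (Suc n) * (b \<bullet> i - x \<bullet> i)))"

lemma box_bump_eq_0: "x \<notin> box a b \<Longrightarrow> box_bump a b n x = 0"
  by (auto simp: box_bump_def mem_box flat_exp_def zero_less_mult_iff)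

lemma flat_exp_0_bounds: "0 \<le> flat_exp 0 t" "flat_exp 0 t \<le> 1"
  by (auto simp: flat_exp_def)

lemma box_bump_bounds: "0 \<le> box_bump a b n x" "box_bump a b n x \<le> 1"
  unfolding box_bump_def
  by (auto intro!: prod_nonneg prod_le_1 mult_le_one flat_exp_0_bounds mult_nonneg_nonneg)

lemma flat_exp_0_scaled_tendsto:
  assumes "t > 0"
  shows "(\<lambda>n. flat_exp 0 (real (Suc n) * t)) \<longlonglongrightarrow> 1"
proof -
  have "(\<lambda>n. exp (- (inverse (real (Suc n)) * (1 / t)))) \<longlonglongrightarrow> exp (- (0 * (1 / t)))"
    by (intro tendsto_intros LIMSEQ_inverse_real_of_nat)
  moreover have "exp (- (inverse (real (Suc n)) * (1 / t))) = flat_exp 0 (real (Suc n) * t)" for n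
    using assms by (simp add: flat_exp_def zero_less_mult_iff inverse_eq_divide del: of_nat_Suc)
  ultimately show ?thesis by (simp del: of_nat_Suc)
qed

lemma box_bump_tendsto: "(\<lambda>n. box_bump a b n x) \<longlonglongrightarrow> indicator (box a b) x"
proof (cases "x \<in> box a b")
  case True
  have "(\<lambda>n. box_bump a b n x) \<longlonglongrightarrow> (\<Prod>i\<in>(Basis::'a set). 1 * 1)"
    unfolding box_bump_def
    by (intro tendsto_intros flat_exp_0_scaled_tendsto) (use True in \<open>auto simp: mem_box\<close>)
  with True show ?thesis by simp
qed (simp add: box_bump_eq_0)

lemma box_bump_test_function:
  assumes "cbox a b \<subseteq> \<Omega>"
  shows "box_bump a b n \<in> test_functions \<Omega>"
proof -
  have "Ck k (box_bump a b n)" for k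
  proof -
    have *: "real (Suc n) * (x \<bullet> i - a \<bullet> i) = x \<bullet> (real (Suc n) *\<^sub>R i) + (- real (Suc n) * (a \<bullet> i))"
      "real (Suc n) * (b \<bullet> i - x \<bullet> i) = x \<bullet> (- real (Suc n) *\<^sub>R i) + real (Suc n) * (b \<bullet> i)" for x i
      by (simp_all add: algebra_simps)
    show ?thesis
      unfolding box_bump_def * by (intro Ck_prod Ck_mult Ck_flat_exp)
  qed
  moreover have "closure {x. box_bump a b n x \<noteq> 0} \<subseteq> cbox a b"
    using box_bump_eq_0[of _ a b n] box_subset_cbox[of a b] by (intro closure_minimal) auto
  moreover from this have "compact (closure {x. box_bump a b n x \<noteq> 0})"
    using bounded_subset[OF bounded_cbox] by (simp add: compact_eq_bounded_closed)
  ultimately show ?thesis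
    using assms by (auto simp: test_functions_def)
qed

text \<open>
  Testing with bumps and passing to the limit shows that the integral of \<open>h\<close> over every box inside the
  domain is zero; Lebesgue's differentiation theorem then recovers \<open>h\<close> almost everywhere.
\<close>

lemma L2_eq_0_if_orthogonal_to_test_functions:
  fixes h :: "'a::euclidean_space \<Rightarrow> real"
  assumes \<Omega>: "open \<Omega>" "bounded \<Omega>" and h: "h \<in> L2 \<Omega>"
    and orth: "\<And>\<phi>. \<phi> \<in> test_functions \<Omega> \<Longrightarrow> L2_inner \<Omega> h \<phi> = 0"
  shows "AE x in lebesgue_on \<Omega>. h x = 0"
proof -
  have S: "\<Omega> \<in> sets lebesgue" using \<Omega> by simp
  have int: "integrable (lebesgue_on \<Omega>) h" using L2_integrable[OF h \<Omega>(2) S] .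
  define f where "f x = (if x \<in> \<Omega> then h x else 0)" for x
  have intf: "integrable lebesgue f"
    using int unfolding f_def by (simp add: Lebesgue_Measure.integrable_restrict_UNIV S)
  have zero: "integral (cbox a b) f = 0" if ab: "cbox a b \<subseteq> \<Omega>" for a b
  proof -
    have "(\<lambda>n. L2_inner \<Omega> h (box_bump a b n)) \<longlonglongrightarrow> (LINT x|lebesgue_on \<Omega>. h x * indicator (box a b) x)"
      unfolding L2_inner_def inner_real_def
    proof (rule integral_dominated_convergence[where w = "\<lambda>x. \<bar>h x\<bar>"])
      have "continuous_on UNIV (box_bump a b n)" for n
        using box_bump_test_function[OF ab, of n] Ck.simps(1)[of "box_bump a b n"]
        by (simp add: test_functions_def)
      then have m: "box_bump a b n \<in> borel_measurable (lebesgue_on \<Omega>)" for n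
        using S by (intro continuous_imp_measurable_on_sets_lebesgue) (auto intro: continuous_on_subset)
      show "(\<lambda>x. h x * box_bump a b n x) \<in> borel_measurable (lebesgue_on \<Omega>)" for n
        using m int by (intro borel_measurable_times) auto
      show "(\<lambda>x. h x * indicator (box a b) x) \<in> borel_measurable (lebesgue_on \<Omega>)"
        using int by (intro borel_measurable_times) (auto intro!: measurable_restrict_space1[OF borel_measurable_indicator])
      show "AE x in lebesgue_on \<Omega>. (\<lambda>n. h x * box_bump a b n x) \<longlonglongrightarrow> h x * indicator (box a b) x"
        by (intro always_eventually allI tendsto_mult tendsto_const box_bump_tendsto)
      show "AE x in lebesgue_on \<Omega>. norm (h x * box_bump a b n x) \<le> \<bar>h x\<bar>" for n
        using box_bump_bounds[of a b n] by (intro always_eventually) (auto simp: abs_mult intro: mult_left_le)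
    qed (use int in auto)
    then have "(LINT x|lebesgue_on \<Omega>. h x * indicator (box a b) x) = 0"
      using orth[OF box_bump_test_function[OF ab]] by (simp add: LIMSEQ_const_iff)
    moreover have "(LINT x|lebesgue_on \<Omega>. h x * indicator (box a b) x)
        = (LINT x|lebesgue. (if x \<in> \<Omega> then h x * indicator (box a b) x else 0))"
      by (simp add: Lebesgue_Measure.integral_restrict_UNIV S)
    moreover have "\<dots> = (LINT x|lebesgue_on (box a b). f x)"
      unfolding f_def
      by (subst Lebesgue_Measure.integral_restrict_UNIV[symmetric])
        (auto intro!: Bochner_Integration.integral_cong simp: indicator_def)
    moreover have "\<dots> = integral (box a b) f"
      using intf by (intro integral_unique[symmetric] has_integral_integral_lebesgue_on)
         (use integrable_mult_indicator[OF _ intf, of "box a b"] in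
           \<open>simp_all add: integrable_restrict_space\<close>)
    ultimately show ?thesis
      by (simp add: integral_open_interval)
  qed
  have "f integrable_on cbox a b" for a b
    using has_integral_integral_lebesgue[OF intf] integrable_on_subcbox[of f UNIV]
    by (auto simp: integrable_on_def)
  then obtain N where N: "negligible N"
    "\<And>x e. \<lbrakk>x \<notin> N; 0 < e\<rbrakk> \<Longrightarrow> \<exists>d>0. \<forall>k. 0 < k \<and> k < d \<longrightarrow>
        norm (integral (cbox x (x + k *\<^sub>R One)) f /\<^sub>R k ^ DIM('a) - f x) < e"
    using integrable_ccontinuous_explicit[of f] by metis
  have "h x = 0" if x: "x \<in> \<Omega>" "x \<notin> N" for x
  proof (rule ccontr)
    assume "h x \<noteq> 0"
    then obtain d where d: "d > 0" "\<forall>k. 0 < k \<and> k < d \<longrightarrow>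
        norm (integral (cbox x (x + k *\<^sub>R One)) f /\<^sub>R k ^ DIM('a) - f x) < \<bar>h x\<bar>"
      using N(2)[OF x(2), of "\<bar>h x\<bar>"] by auto
    obtain r where r: "r > 0" "cball x r \<subseteq> \<Omega>"
      using \<Omega>(1) x(1) open_contains_cball by blast
    \<comment> \<open>The cube at \<open>x\<close> with side \<open>k\<close> lies in the ball of radius \<open>r\<close>, by comparison with the \<open>l\<^sup>1\<close> norm.\<close>
    define k where "k = min (d / 2) (r / DIM('a))"
    have k: "0 < k" "k < d" "k * DIM('a) \<le> r"
      using d r by (auto simp: k_def min_def field_simps)
    have "cbox x (x + k *\<^sub>R One) \<subseteq> cball x r"
    proof
      fix y assume y: "y \<in> cbox x (x + k *\<^sub>R One)"
      have "norm (y - x) \<le> (\<Sum>i\<in>Basis. \<bar>(y - x) \<bullet> i\<bar>)" by (rule norm_le_l1)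
      also have "\<dots> \<le> (\<Sum>i\<in>(Basis::'a set). k)"
        using y by (intro sum_mono) (auto simp: mem_box inner_simps)
      also have "\<dots> \<le> r" using k by (simp add: mult.commute)
      finally show "y \<in> cball x r" by (simp add: dist_norm norm_minus_commute)
    qed
    then have "integral (cbox x (x + k *\<^sub>R One)) f = 0" using r zero by blast
    with d(2) k have "\<bar>f x\<bar> < \<bar>h x\<bar>" by force
    with x show False by (simp add: f_def)
  qed
  then have "AE x in lebesgue. x \<in> \<Omega> \<longrightarrow> h x = 0"
    using N(1) by (intro AE_I'[of N]) (auto simp: negligible_iff_null_sets)
  then show ?thesis using S by (simp add: AE_restrict_space_iff)
qed

section \<open>Classical derivatives are weak derivatives\<close>

text \<open>
  By translation invariance the integrals of the difference quotients in direction \<open>w\<close> vanish; the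
  bounded support and the mean value theorem allow the limit to be taken under the integral.
\<close>

lemma integral_directional_derivative_eq_0:
  fixes g :: "'a::euclidean_space \<Rightarrow> real"
  assumes g: "\<And>x. (g has_derivative g' x) (at x)"
    and cont: "continuous_on UNIV (\<lambda>x. g' x w)"
    and supp: "bounded {x. g x \<noteq> 0}"
  shows "(LINT x|lebesgue. g' x w) = 0"
proof -
  obtain r where r: "\<And>x. g x \<noteq> 0 \<Longrightarrow> norm x \<le> r" using supp by (auto simp: bounded_iff)
  have cg: "continuous_on UNIV g"
    using g has_derivative_continuous_on[of UNIV g g'] by simp
  then have bg[measurable]: "g \<in> borel_measurable borel" by (rule borel_measurable_continuous_onI)
  have bg'[measurable]: "(\<lambda>x. g' x w) \<in> borel_measurable borel"
    using cont by (rule borel_measurable_continuous_onI)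
  have "integrable lborel (\<lambda>x. indicator (cball 0 r) x *\<^sub>R g x)"
    by (rule borel_integrable_compact) (use cg in \<open>auto intro: continuous_on_subset\<close>)
  moreover have "(\<lambda>x. indicator (cball 0 r) x *\<^sub>R g x) = g"
    using r by (force simp: indicator_def)
  ultimately have ig: "integrable lborel g" by simp
  define t where "t n = 1 / real (Suc n)" for n
  have t: "0 < t n" "t n \<le> 1" for n by (auto simp: t_def)
  have shift: "integrable lborel (\<lambda>x. g (c + x))" "(LINT x|lborel. g (c + x)) = (LINT x|lborel. g x)" for c
    using ig integrable_distr_eq[of "(+) c" lborel borel g] integral_distr[of "(+) c" lborel borel g]
    by (simp_all add: lborel_distr_plus)
  have "compact ((\<lambda>x. g' x w) ` cball 0 (r + 2 * norm w))"
    using cont by (intro compact_continuous_image) (auto intro: continuous_on_subset)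
  then obtain M where M: "\<And>x. norm x \<le> r + 2 * norm w \<Longrightarrow> \<bar>g' x w\<bar> \<le> M"
    unfolding compact_eq_bounded_closed bounded_iff by fastforce
  have "(\<lambda>n. LINT x|lborel. (g (t n *\<^sub>R w + x) - g x) / t n) \<longlonglongrightarrow> (LINT x|lborel. g' x w)"
  proof (rule integral_dominated_convergence[where w = "\<lambda>x. indicator (cball 0 (r + norm w)) x *\<^sub>R M"])
    show "integrable lborel (\<lambda>x. indicator (cball (0::'a) (r + norm w)) x *\<^sub>R M)"
      by (rule borel_integrable_compact) auto
    show "AE x in lborel. (\<lambda>n. (g (t n *\<^sub>R w + x) - g x) / t n) \<longlonglongrightarrow> g' x w"
    proof (intro AE_I2)
      fix x
      have "((\<lambda>s. g (x + s *\<^sub>R w)) has_derivative (\<lambda>s. g' x (s *\<^sub>R w))) (at 0)"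
        by (rule has_derivative_compose[where f = "\<lambda>s. x + s *\<^sub>R w" and g = g])
          (use g[of x] in \<open>auto intro!: derivative_eq_intros\<close>)
      moreover have "(\<lambda>s. g' x (s *\<^sub>R w)) = (*) (g' x w)"
        using g[THEN has_derivative_linear] by (auto simp: linear_cmul)
      ultimately have "((\<lambda>s. g (x + s *\<^sub>R w)) has_real_derivative g' x w) (at 0)"
        by (simp add: has_field_derivative_def)
      then have "((\<lambda>s. (g (x + s *\<^sub>R w) - g x) / s) \<longlongrightarrow> g' x w) (at 0)"
        by (simp add: has_field_derivative_iff)
      moreover have "filterlim t (at 0) sequentially"
        using t LIMSEQ_Suc[OF lim_1_over_n[where 'a=real]] unfolding filterlim_at t_def
        by (auto intro!: always_eventually)
      ultimately have "(\<lambda>n. (g (x + t n *\<^sub>R w) - g x) / t n) \<longlonglongrightarrow> g' x w"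
        by (rule filterlim_compose)
      then show "(\<lambda>n. (g (t n *\<^sub>R w + x) - g x) / t n) \<longlonglongrightarrow> g' x w"
        by (simp add: add.commute)
    qed
    show "AE x in lborel. norm ((g (t n *\<^sub>R w + x) - g x) / t n)
        \<le> indicator (cball 0 (r + norm w)) x *\<^sub>R M" for n
    proof (intro AE_I2)
      fix x
      have tw: "norm (s *\<^sub>R w) \<le> norm w" if "0 \<le> s" "s \<le> t n" for s
        using that t[of n] by (simp add: mult_left_le_one_le)
      show "norm ((g (t n *\<^sub>R w + x) - g x) / t n) \<le> indicator (cball 0 (r + norm w)) x *\<^sub>R M"
      proof (cases "norm x \<le> r + norm w")
        case True
        have "\<exists>s>0. s < t n \<and> g (x + t n *\<^sub>R w) - g (x + 0 *\<^sub>R w) = (t n - 0) * g' (x + s *\<^sub>R w) w"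
        proof (rule MVT2)
          show "((\<lambda>s. g (x + s *\<^sub>R w)) has_real_derivative g' (x + s *\<^sub>R w) w) (at s)" for s
          proof -
            have "((\<lambda>s. g (x + s *\<^sub>R w)) has_derivative (\<lambda>k. g' (x + s *\<^sub>R w) (k *\<^sub>R w))) (at s)"
              by (rule has_derivative_compose[where f = "\<lambda>s. x + s *\<^sub>R w" and g = g])
                (use g in \<open>auto intro!: derivative_eq_intros\<close>)
            moreover have "(\<lambda>k. g' (x + s *\<^sub>R w) (k *\<^sub>R w)) = (*) (g' (x + s *\<^sub>R w) w)"
              using g[THEN has_derivative_linear] by (auto simp: linear_cmul)
            ultimately show ?thesis by (simp add: has_field_derivative_def)
          qed
        qed (rule t)
        then obtain s where s: "0 < s" "s < t n"
          "g (t n *\<^sub>R w + x) - g x = t n * g' (x + s *\<^sub>R w) w"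
          by (auto simp: add.commute)
        have "norm (x + s *\<^sub>R w) \<le> r + 2 * norm w"
          using True tw[of s] s norm_triangle_ineq[of x "s *\<^sub>R w"] by linarith
        then show ?thesis using M[of "x + s *\<^sub>R w"] True s t[of n] by simp
      next
        case False
        have "norm x \<le> norm (t n *\<^sub>R w + x) + norm (t n *\<^sub>R w)"
          using norm_triangle_ineq4[of "t n *\<^sub>R w + x" "t n *\<^sub>R w"] by simp
        then have "norm (t n *\<^sub>R w + x) > r" using False tw[of "t n"] t[of n] by linarith
        moreover have "norm x > r" using False by (smt (verit) norm_ge_zero)
        ultimately have "g (t n *\<^sub>R w + x) = 0" "g x = 0" using r by force+
        then show ?thesis using False by simp
      qed
    qed
  qed auto
  moreover have "(LINT x|lborel. (g (t n *\<^sub>R w + x) - g x) / t n) = 0" for n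
    using shift ig by simp
  ultimately have "(\<lambda>n. 0) \<longlonglongrightarrow> (LINT x|lborel. g' x w)" by (simp only:)
  then have "(LINT x|lborel. g' x w) = 0" by (simp add: LIMSEQ_const_iff)
  then show ?thesis by (simp add: integral_completion)
qed

lemma test_functionD:
  assumes "\<phi> \<in> test_functions \<Omega>"
  shows "(\<phi> has_derivative frechet_derivative \<phi> (at x)) (at x)"
    and "continuous_on UNIV \<phi>"
    and "continuous_on UNIV (\<lambda>x. frechet_derivative \<phi> (at x) w)"
proof -
  have C: "Ck (Suc 0) \<phi>" using assms by (auto simp: test_functions_def simp del: Ck.simps)
  show d: "(\<phi> has_derivative frechet_derivative \<phi> (at x)) (at x)" for x
    using Ck_SucD(1)[OF C] .
  show "continuous_on UNIV \<phi>" using Ck_Suc_imp_Ck[OF C] by simp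
  have "frechet_derivative \<phi> (at x) w = (\<Sum>b\<in>Basis. (w \<bullet> b) * frechet_derivative \<phi> (at x) b)" for x
  proof -
    have lin: "linear (frechet_derivative \<phi> (at x))" using d by (rule has_derivative_linear)
    have "frechet_derivative \<phi> (at x) w = frechet_derivative \<phi> (at x) (\<Sum>b\<in>Basis. (w \<bullet> b) *\<^sub>R b)"
      by (simp add: euclidean_representation)
    also have "\<dots> = (\<Sum>b\<in>Basis. (w \<bullet> b) * frechet_derivative \<phi> (at x) b)"
      by (simp add: linear_sum[OF lin] linear_cmul[OF lin])
    finally show ?thesis .
  qed
  then show "continuous_on UNIV (\<lambda>x. frechet_derivative \<phi> (at x) w)"
    using Ck_SucD(2)[OF C] by (auto intro!: continuous_intros)
qed

text \<open>
  The product \<open>f * \<phi>\<close> has compact support in the domain, so the integral of its derivative is zero.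
\<close>

lemma integration_by_parts_test_function:
  fixes f :: "'a::euclidean_space \<Rightarrow> real"
  assumes \<Omega>: "open \<Omega>" "bounded \<Omega>"
    and f: "\<And>x. (f has_derivative f' x) (at x)" "continuous_on UNIV (\<lambda>x. f' x w)"
    and \<phi>: "\<phi> \<in> test_functions \<Omega>"
  shows "(LINT x|lebesgue_on \<Omega>. f x * frechet_derivative \<phi> (at x) w)
    = - (LINT x|lebesgue_on \<Omega>. f' x w * \<phi> x)"
proof -
  define D where "D x = frechet_derivative \<phi> (at x) w" for x
  have cf: "continuous_on UNIV f"
    using f(1) has_derivative_continuous_on[of UNIV f f'] by simp
  have cD: "continuous_on UNIV D" unfolding D_def by (rule test_functionD(3)[OF \<phi>])
  note c = cf f(2) cD test_functionD(2)[OF \<phi>]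
  have S: "\<Omega> \<in> sets lebesgue" using \<Omega> by simp
  have int: "integrable (lebesgue_on \<Omega>) (\<lambda>x. f x * D x)" "integrable (lebesgue_on \<Omega>) (\<lambda>x. f' x w * \<phi> x)"
    by (rule L2_integrable[OF L2_of_continuous[OF \<Omega>] \<Omega>(2) S], intro continuous_on_mult c)+
  have der: "((\<lambda>x. f x * \<phi> x) has_derivative (\<lambda>h. f x * frechet_derivative \<phi> (at x) h + f' x h * \<phi> x)) (at x)" for x
    by (rule has_derivative_mult[OF f(1) test_functionD(1)[OF \<phi>]])
  have supp: "compact (closure {x. \<phi> x \<noteq> 0})" "closure {x. \<phi> x \<noteq> 0} \<subseteq> \<Omega>"
    using \<phi> by (auto simp: test_functions_def)
  have "(LINT x|lebesgue. f x * D x + f' x w * \<phi> x) = 0"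
    unfolding D_def
  proof (rule integral_directional_derivative_eq_0[OF der])
    show "continuous_on UNIV (\<lambda>x. f x * frechet_derivative \<phi> (at x) w + f' x w * \<phi> x)"
      using c unfolding D_def by (intro continuous_intros)
    show "bounded {x. f x * \<phi> x \<noteq> 0}"
      using compact_imp_bounded[OF supp(1)] closure_subset[of "{x. \<phi> x \<noteq> 0}"]
      by (elim bounded_subset) auto
  qed
  moreover have "f x * D x + f' x w * \<phi> x = 0" if "x \<notin> \<Omega>" for x
  proof -
    have "((\<lambda>x. 0) has_derivative frechet_derivative \<phi> (at x)) (at x)"
    proof (rule has_derivative_transform_within_open[OF test_functionD(1)[OF \<phi>]])
      show "open (- closure {x. \<phi> x \<noteq> 0})" by auto
      show "x \<in> - closure {x. \<phi> x \<noteq> 0}" using that supp by auto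
      show "\<phi> y = 0" if "y \<in> - closure {x. \<phi> x \<noteq> 0}" for y
        using that closure_subset[of "{x. \<phi> x \<noteq> 0}"] by auto
    qed
    then have "frechet_derivative \<phi> (at x) = (\<lambda>h. 0)"
      using has_derivative_unique has_derivative_const by blast
    moreover have "\<phi> x = 0" using that supp closure_subset[of "{x. \<phi> x \<noteq> 0}"] by auto
    ultimately show ?thesis by (simp add: D_def)
  qed
  then have "(LINT x|lebesgue. f x * D x + f' x w * \<phi> x)
      = (LINT x|lebesgue. (if x \<in> \<Omega> then f x * D x + f' x w * \<phi> x else 0))"
    by (intro Bochner_Integration.integral_cong) auto
  ultimately have "(LINT x|lebesgue_on \<Omega>. f x * D x + f' x w * \<phi> x) = 0"
    by (simp add: Lebesgue_Measure.integral_restrict_UNIV S)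
  then show ?thesis using int by (simp add: D_def)
qed

text \<open>
  Applied to the component \<open>i\<close>, the defining identity says that the difference of two weak gradients is
  orthogonal to all test functions.
\<close>

lemma has_weak_grad_unique:
  assumes \<Omega>: "open \<Omega>" "bounded \<Omega>" and g: "has_weak_grad P \<Omega> f g" "has_weak_grad P \<Omega> f h"
  shows "AE x in lebesgue_on \<Omega>. g x = h x"
proof -
  have L: "g \<in> L2 \<Omega>" "h \<in> L2 \<Omega>" using g by (auto simp: has_weak_grad_def)
  have "AE x in lebesgue_on \<Omega>. g x $ i - h x $ i = 0" for i
  proof (rule L2_eq_0_if_orthogonal_to_test_functions[OF \<Omega>])
    show "(\<lambda>x. g x $ i - h x $ i) \<in> L2 \<Omega>" using L by (intro L2_diff L2_component)
    fix \<phi> assume \<phi>: "\<phi> \<in> test_functions \<Omega>"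
    have "\<phi> \<in> L2 \<Omega>" using \<Omega> test_functionD(2)[OF \<phi>] by (rule L2_of_continuous)
    then have "integrable (lebesgue_on \<Omega>) (\<lambda>x. g x $ i * \<phi> x)" "integrable (lebesgue_on \<Omega>) (\<lambda>x. h x $ i * \<phi> x)"
      using L2_inner_integrable[OF L2_component] L by fastforce+
    moreover have "L2_inner \<Omega> (\<lambda>x. g x $ i) \<phi> = L2_inner \<Omega> (\<lambda>x. h x $ i) \<phi>"
      using g \<phi> unfolding has_weak_grad_def by (metis neg_equal_iff_equal)
    ultimately show "L2_inner \<Omega> (\<lambda>x. g x $ i - h x $ i) \<phi> = 0"
      by (simp add: L2_inner_def left_diff_distrib)
  qed
  then have "AE x in lebesgue_on \<Omega>. \<forall>i. g x $ i - h x $ i = 0" by (simp add: AE_all_countable)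
  then show ?thesis by (auto simp: vec_eq_iff)
qed

lemma has_weak_curl_unique:
  assumes \<Omega>: "open \<Omega>" "bounded \<Omega>" and g: "has_weak_curl P \<Omega> f g" "has_weak_curl P \<Omega> f h"
  shows "AE x in lebesgue_on \<Omega>. g x = h x"
proof -
  have L: "g \<in> L2 \<Omega>" "h \<in> L2 \<Omega>" using g by (auto simp: has_weak_curl_def)
  have "AE x in lebesgue_on \<Omega>. g x $ i - h x $ i = 0" for i
  proof (rule L2_eq_0_if_orthogonal_to_test_functions[OF \<Omega>])
    show "(\<lambda>x. g x $ i - h x $ i) \<in> L2 \<Omega>" using L by (intro L2_diff L2_component)
    fix \<phi> assume \<phi>: "\<phi> \<in> test_functions \<Omega>"
    have "\<phi> \<in> L2 \<Omega>" using \<Omega> test_functionD(2)[OF \<phi>] by (rule L2_of_continuous)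
    then have int: "integrable (lebesgue_on \<Omega>) (\<lambda>x. g x $ i * \<phi> x)" "integrable (lebesgue_on \<Omega>) (\<lambda>x. h x $ i * \<phi> x)"
      using L2_inner_integrable[OF L2_component] L by fastforce+
    have "(\<lambda>x. 0) \<in> test_functions \<Omega>" by (auto simp: test_functions_def Ck_const)
    then have "(\<lambda>x. axis i (\<phi> x) $ j) \<in> test_functions \<Omega>" for j
      using \<phi> by (cases "j = i") (simp_all add: axis_def)
    then have "(\<lambda>x. axis i (\<phi> x)) \<in> test_fields \<Omega>" by (simp add: test_fields_def)
    then have "L2_inner \<Omega> g (\<lambda>x. axis i (\<phi> x)) = L2_inner \<Omega> h (\<lambda>x. axis i (\<phi> x))"
      using g unfolding has_weak_curl_def by metis
    with int show "L2_inner \<Omega> (\<lambda>x. g x $ i - h x $ i) \<phi> = 0"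
      by (simp add: L2_inner_def left_diff_distrib inner_axis)
  qed
  then have "AE x in lebesgue_on \<Omega>. \<forall>i. g x $ i - h x $ i = 0" by (simp add: AE_all_countable)
  then show ?thesis by (auto simp: vec_eq_iff)
qed

definition C1_with_derivative :: "('a::euclidean_space \<Rightarrow> real) \<Rightarrow> ('a \<Rightarrow> 'a \<Rightarrow> real) \<Rightarrow> bool" where
  "C1_with_derivative f f' \<longleftrightarrow>
     (\<forall>x. (f has_derivative f' x) (at x)) \<and> (\<forall>w. continuous_on UNIV (\<lambda>x. f' x w))"

lemma C1_with_derivativeD:
  assumes "C1_with_derivative f f'"
  shows "(f has_derivative f' x) (at x)" "continuous_on UNIV (\<lambda>x. f' x w)" "continuous_on UNIV f"
  using assms has_derivative_continuous_on[of UNIV f f'] by (auto simp: C1_with_derivative_def)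

lemma has_weak_grad_classical:
  assumes \<Omega>: "open \<Omega>" "bounded \<Omega>" and f: "C1_with_derivative f f'"
  shows "has_weak_grad P \<Omega> f (\<lambda>x. \<chi> i. f' x (P (axis i 1)))"
  unfolding has_weak_grad_def
proof (intro conjI ballI allI)
  show "(\<lambda>x. \<chi> i. f' x (P (axis i 1))) \<in> L2 \<Omega>"
    using \<Omega> by (intro L2_of_continuous continuous_on_vec_lambda C1_with_derivativeD[OF f])
  show "L2_inner \<Omega> f (pderiv_axis P i \<phi>) = - L2_inner \<Omega> (\<lambda>x. (\<chi> i. f' x (P (axis i 1))) $ i) \<phi>"
    if "\<phi> \<in> test_functions \<Omega>" for \<phi> i
    using integration_by_parts_test_function[OF \<Omega> C1_with_derivativeD(1,2)[OF f] that]
    by (simp add: L2_inner_def pderiv_axis_def)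
qed

lemma has_weak_curl_classical:
  assumes \<Omega>: "open \<Omega>" "bounded \<Omega>" and f: "C1_with_derivative f f'"
  shows "has_weak_curl P \<Omega> (\<lambda>x. f x *\<^sub>R e) (\<lambda>x. cross3 (\<chi> i. f' x (P (axis i 1))) e)"
  unfolding has_weak_curl_def
proof (intro conjI ballI)
  show "(\<lambda>x. cross3 (\<chi> i. f' x (P (axis i 1))) e) \<in> L2 \<Omega>"
    using \<Omega> by (intro L2_of_continuous continuous_on_cross continuous_on_vec_lambda
        C1_with_derivativeD[OF f] continuous_on_const)
  fix \<psi> assume "\<psi> \<in> test_fields \<Omega>"
  then have \<psi>: "(\<lambda>x. \<psi> x $ i) \<in> test_functions \<Omega>" for i by (simp add: test_fields_def)
  define D where "D j i x = pderiv_axis P j (\<lambda>y. \<psi> y $ i) x" for i j x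
  define G where "G j x = f' x (P (axis j 1))" for j x
  have S: "\<Omega> \<in> sets lebesgue" using \<Omega> by simp
  have ibp: "(LINT x|lebesgue_on \<Omega>. f x * D j i x) = - (LINT x|lebesgue_on \<Omega>. G j x * \<psi> x $ i)" for i j
    using integration_by_parts_test_function[OF \<Omega> C1_with_derivativeD(1,2)[OF f] \<psi>]
    by (simp add: D_def G_def pderiv_axis_def)
  have int: "integrable (lebesgue_on \<Omega>) (\<lambda>x. f x * D j i x)"
      "integrable (lebesgue_on \<Omega>) (\<lambda>x. G j x * \<psi> x $ i)" for i j
  proof -
    have "continuous_on UNIV (D j i)" "continuous_on UNIV (G j)" "continuous_on UNIV (\<lambda>x. \<psi> x $ i)"
      using test_functionD[OF \<psi>] C1_with_derivativeD[OF f] by (auto simp: D_def G_def pderiv_axis_def)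
    then show "integrable (lebesgue_on \<Omega>) (\<lambda>x. f x * D j i x)"
      "integrable (lebesgue_on \<Omega>) (\<lambda>x. G j x * \<psi> x $ i)"
      using C1_with_derivativeD(3)[OF f]
      by (auto intro!: L2_integrable[OF L2_of_continuous[OF \<Omega>] \<Omega>(2) S] continuous_on_mult)
  qed
  have "L2_inner \<Omega> (\<lambda>x. f x *\<^sub>R e) (curl P \<psi>) =
    (LINT x|lebesgue_on \<Omega>. e $ 1 * (f x * D 2 3 x) - e $ 1 * (f x * D 3 2 x)
      + e $ 2 * (f x * D 3 1 x) - e $ 2 * (f x * D 1 3 x)
      + e $ 3 * (f x * D 1 2 x) - e $ 3 * (f x * D 2 1 x))"
    unfolding L2_inner_def curl_def
    by (intro Bochner_Integration.integral_cong refl)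
      (simp add: inner_vec_def sum_3 D_def[symmetric] algebra_simps)
  also have "\<dots> = (LINT x|lebesgue_on \<Omega>. e $ 1 * (G 3 x * \<psi> x $ 2) - e $ 1 * (G 2 x * \<psi> x $ 3)
      + e $ 2 * (G 1 x * \<psi> x $ 3) - e $ 2 * (G 3 x * \<psi> x $ 1)
      + e $ 3 * (G 2 x * \<psi> x $ 1) - e $ 3 * (G 1 x * \<psi> x $ 2))"
    using int by (simp add: ibp)
  also have "\<dots> = L2_inner \<Omega> (\<lambda>x. cross3 (\<chi> i. f' x (P (axis i 1))) e) \<psi>"
    unfolding L2_inner_def
    by (intro Bochner_Integration.integral_cong refl)
      (simp add: cross3_def inner_vec_def sum_3 G_def[symmetric] algebra_simps)
  finally show "L2_inner \<Omega> (\<lambda>x. f x *\<^sub>R e) (curl P \<psi>)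
    = L2_inner \<Omega> (\<lambda>x. cross3 (\<chi> i. f' x (P (axis i 1))) e) \<psi>" .
qed

lemma L2_inner_cong_AE:
  assumes "AE x in lebesgue_on \<Omega>. g x = h x" "v \<in> L2 \<Omega>" "g \<in> L2 \<Omega>" "h \<in> L2 \<Omega>"
  shows "L2_inner \<Omega> v g = L2_inner \<Omega> v h"
  unfolding L2_inner_def
  by (rule integral_cong_AE) (use assms in \<open>auto simp: L2_def\<close>)

lemma HDC0_D:
  assumes "v \<in> HDC0 P \<Omega>"
  shows "v \<in> L2 \<Omega>" "weak_div P \<Omega> v \<in> L2 \<Omega>" "weak_curl P \<Omega> v \<in> L2 \<Omega>"
proof -
  have v: "v \<in> HDC P \<Omega>" using assms by (simp add: HDC0_def)
  then show "v \<in> L2 \<Omega>" by (simp add: HDC_def)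
  have "has_weak_div P \<Omega> v (weak_div P \<Omega> v)" "has_weak_curl P \<Omega> v (weak_curl P \<Omega> v)"
    using v someI_ex[of "has_weak_div P \<Omega> v"] someI_ex[of "has_weak_curl P \<Omega> v"]
    by (auto simp: HDC_def weak_div_def weak_curl_def)
  then show "weak_div P \<Omega> v \<in> L2 \<Omega>" "weak_curl P \<Omega> v \<in> L2 \<Omega>"
    by (auto simp: has_weak_div_def has_weak_curl_def)
qed

text \<open>
  The normal trace pairs \<open>v\<close> with the chosen weak gradient of \<open>f\<close>. By uniqueness that gradient may be
  replaced by the classical one, and the vanishing of the trace becomes Green's formula without boundary
  term, although \<open>f\<close> need not vanish on the boundary.
\<close>

lemma HDC0_div_identity:
  assumes \<Omega>: "open \<Omega>" "bounded \<Omega>" and f: "C1_with_derivative f f'" and v: "v \<in> HDC0 P \<Omega>"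
  shows "L2_inner \<Omega> v (\<lambda>x. \<chi> i. f' x (P (axis i 1))) = - L2_inner \<Omega> (weak_div P \<Omega> v) f"
proof -
  note wg = has_weak_grad_classical[OF \<Omega> f, of P]
  have sg: "has_weak_grad P \<Omega> f (weak_grad P \<Omega> f)"
    unfolding weak_grad_def by (rule someI[of "has_weak_grad P \<Omega> f", OF wg])
  have "f \<in> H1 P \<Omega>"
    using wg L2_of_continuous[OF \<Omega> C1_with_derivativeD(3)[OF f]] by (auto simp: H1_def)
  then have "normal_trace P \<Omega> v f = 0" using v by (simp add: HDC0_def)
  moreover have "L2_inner \<Omega> v (weak_grad P \<Omega> f) = L2_inner \<Omega> v (\<lambda>x. \<chi> i. f' x (P (axis i 1)))"
    by (rule L2_inner_cong_AE[OF has_weak_grad_unique[OF \<Omega> sg wg] HDC0_D(1)[OF v]])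
      (use wg sg in \<open>auto simp: has_weak_grad_def\<close>)
  ultimately show ?thesis by (simp add: normal_trace_def)
qed

lemma C1_with_derivative_mult_const:
  assumes "C1_with_derivative f f'"
  shows "C1_with_derivative (\<lambda>x. f x * c) (\<lambda>x h. f' x h * c)"
  using C1_with_derivativeD[OF assms]
  by (auto simp: C1_with_derivative_def intro!: has_derivative_mult_left continuous_on_mult_right)

text \<open>
  Likewise for the tangential trace, tested with a scalar function times a constant vector, whose curl
  is the cross product of the gradient with that vector.
\<close>

lemma HDC0_curl_identity:
  assumes \<Omega>: "open \<Omega>" "bounded \<Omega>" and f: "C1_with_derivative f f'" and v: "v \<in> HDC0 P \<Omega>"
  shows "L2_inner \<Omega> v (\<lambda>x. cross3 (\<chi> i. f' x (P (axis i 1))) e)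
    = L2_inner \<Omega> (weak_curl P \<Omega> v) (\<lambda>x. f x *\<^sub>R e)"
proof -
  note wc = has_weak_curl_classical[OF \<Omega> f, of P e]
  have sc: "has_weak_curl P \<Omega> (\<lambda>x. f x *\<^sub>R e) (weak_curl P \<Omega> (\<lambda>x. f x *\<^sub>R e))"
    unfolding weak_curl_def[of P \<Omega> "\<lambda>x. f x *\<^sub>R e"]
    by (rule someI[of "has_weak_curl P \<Omega> (\<lambda>x. f x *\<^sub>R e)", OF wc])
  have "(\<lambda>x. (f x *\<^sub>R e) $ i) \<in> H1 P \<Omega>" for i
  proof -
    note g = C1_with_derivative_mult_const[OF f, of "e $ i"]
    show ?thesis
      using has_weak_grad_classical[OF \<Omega> g, of P] L2_of_continuous[OF \<Omega> C1_with_derivativeD(3)[OF g]]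
      by (auto simp: H1_def)
  qed
  then have "tangential_trace P \<Omega> v (\<lambda>x. f x *\<^sub>R e) = 0"
    using v by (simp add: HDC0_def H1_fields_def)
  moreover have "L2_inner \<Omega> v (weak_curl P \<Omega> (\<lambda>x. f x *\<^sub>R e))
      = L2_inner \<Omega> v (\<lambda>x. cross3 (\<chi> i. f' x (P (axis i 1))) e)"
    by (rule L2_inner_cong_AE[OF has_weak_curl_unique[OF \<Omega> sc wc] HDC0_D(1)[OF v]])
      (use wc sc in \<open>auto simp: has_weak_curl_def\<close>)
  ultimately show ?thesis by (simp add: tangential_trace_def)
qed

section \<open>Fourier coefficients of fields with vanishing traces\<close>

definition cos_coeff :: "'a::euclidean_space set \<Rightarrow> 'a \<Rightarrow> ('a \<Rightarrow> real) \<Rightarrow> real" where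
  "cos_coeff \<Omega> k f = (LINT x|lebesgue_on \<Omega>. f x * cos (k \<bullet> x))"

definition sin_coeff :: "'a::euclidean_space set \<Rightarrow> 'a \<Rightarrow> ('a \<Rightarrow> real) \<Rightarrow> real" where
  "sin_coeff \<Omega> k f = (LINT x|lebesgue_on \<Omega>. f x * sin (k \<bullet> x))"

text \<open>
  The squared modulus of the complex Fourier coefficient of \<open>f\<close> at the frequency \<open>k\<close>.
\<close>

definition wave_energy :: "'a::euclidean_space set \<Rightarrow> 'a \<Rightarrow> ('a \<Rightarrow> real) \<Rightarrow> real" where
  "wave_energy \<Omega> k f = (cos_coeff \<Omega> k f)\<^sup>2 + (sin_coeff \<Omega> k f)\<^sup>2"

lemma C1_cos_wave: "C1_with_derivative (\<lambda>x. cos (k \<bullet> x)) (\<lambda>x h. - sin (k \<bullet> x) * (k \<bullet> h))"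
  unfolding C1_with_derivative_def
  by (auto intro!: derivative_eq_intros continuous_intros)

lemma C1_sin_wave: "C1_with_derivative (\<lambda>x. sin (k \<bullet> x)) (\<lambda>x h. cos (k \<bullet> x) * (k \<bullet> h))"
  unfolding C1_with_derivative_def
  by (auto intro!: derivative_eq_intros continuous_intros)

lemma integral_inner_mult:
  fixes v :: "'a::euclidean_space \<Rightarrow> real^'n"
  assumes "\<And>i. integrable M (\<lambda>x. v x $ i * g x)"
  shows "(LINT x|M. (v x \<bullet> w) * g x) = (\<chi> i. LINT x|M. v x $ i * g x) \<bullet> w"
proof -
  have "(LINT x|M. (v x \<bullet> w) * g x) = (LINT x|M. (\<Sum>i\<in>UNIV. (v x $ i * g x) * w $ i))"
    by (intro Bochner_Integration.integral_cong refl) (simp add: inner_vec_def sum_distrib_left sum_distrib_right mult_ac)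
  also have "\<dots> = (\<Sum>i\<in>UNIV. (LINT x|M. v x $ i * g x) * w $ i)"
    using assms by (subst Bochner_Integration.integral_sum) auto
  finally show ?thesis by (simp add: inner_vec_def)
qed

text \<open>
  Inserting cosine and sine waves into the two Green formulas turns the divergence into the inner product
  and the curl into the cross product of the coefficient vectors \<open>A v\<close> and \<open>B v\<close> with the frequency \<open>K\<close>,
  pulled back to physical space. Lagrange's identity \<open>norm_cross_dot\<close> combines the two into the full
  squared length.
\<close>

lemma HDC0_wave_energy_balance:
  fixes P :: "real^3 \<Rightarrow> 'a::euclidean_space"
  assumes \<Omega>: "open \<Omega>" "bounded \<Omega>" and v: "v \<in> HDC0 P \<Omega>"
  shows "(norm (\<chi> i. k \<bullet> P (axis i 1) :: real^3))\<^sup>2 * (\<Sum>i\<in>UNIV. wave_energy \<Omega> k (\<lambda>x. v x $ i))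
    = wave_energy \<Omega> k (weak_div P \<Omega> v) + (\<Sum>i\<in>UNIV. wave_energy \<Omega> k (\<lambda>x. weak_curl P \<Omega> v x $ i))"
proof -
  define K :: "real^3" where "K = (\<chi> i. k \<bullet> P (axis i 1))"
  define d c where "d = weak_div P \<Omega> v" and "c = weak_curl P \<Omega> v"
  have L: "v \<in> L2 \<Omega>" "d \<in> L2 \<Omega>" "c \<in> L2 \<Omega>" using HDC0_D[OF v] by (auto simp: d_def c_def)
  have W: "(\<lambda>x. cos (k \<bullet> x)) \<in> L2 \<Omega>" "(\<lambda>x. sin (k \<bullet> x)) \<in> L2 \<Omega>"
    using \<Omega> by (auto intro!: L2_of_continuous continuous_intros)
  have int: "integrable (lebesgue_on \<Omega>) (\<lambda>x. u x $ i * cos (k \<bullet> x))"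
    "integrable (lebesgue_on \<Omega>) (\<lambda>x. u x $ i * sin (k \<bullet> x))" if "u \<in> L2 \<Omega>" for u :: "'a \<Rightarrow> real^3" and i
    using L2_inner_integrable[OF L2_component[OF that] W(1)] L2_inner_integrable[OF L2_component[OF that] W(2)]
    by auto
  define A B :: "('a \<Rightarrow> real^3) \<Rightarrow> real^3" where "A u = (\<chi> i. cos_coeff \<Omega> k (\<lambda>x. u x $ i))"
    and "B u = (\<chi> i. sin_coeff \<Omega> k (\<lambda>x. u x $ i))" for u
  have AB: "(LINT x|lebesgue_on \<Omega>. (u x \<bullet> w) * cos (k \<bullet> x)) = A u \<bullet> w"
    "(LINT x|lebesgue_on \<Omega>. (u x \<bullet> w) * sin (k \<bullet> x)) = B u \<bullet> w" if "u \<in> L2 \<Omega>" for u w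
    using that by (simp_all add: integral_inner_mult int A_def B_def cos_coeff_def sin_coeff_def)
  have sK: "(\<chi> i. - sin (k \<bullet> x) * (k \<bullet> P (axis i 1))) = (- sin (k \<bullet> x)) *\<^sub>R K"
    and cK: "(\<chi> i. cos (k \<bullet> x) * (k \<bullet> P (axis i 1))) = cos (k \<bullet> x) *\<^sub>R K" for x
    by (simp_all add: K_def vec_eq_iff)
  have div1: "B v \<bullet> K = cos_coeff \<Omega> k d"
    using HDC0_div_identity[OF \<Omega> C1_cos_wave v, of k, unfolded sK] AB(2)[OF L(1), of K]
    by (simp add: L2_inner_def cos_coeff_def d_def mult.commute)
  have div2: "A v \<bullet> K = - sin_coeff \<Omega> k d"
    using HDC0_div_identity[OF \<Omega> C1_sin_wave v, of k, unfolded cK] AB(1)[OF L(1), of K]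
    by (simp add: L2_inner_def sin_coeff_def d_def mult.commute)
  have curl1: "A c \<bullet> e = - (B v \<bullet> cross3 K e)" for e
    using HDC0_curl_identity[OF \<Omega> C1_cos_wave v, of k e, unfolded sK] AB(2)[OF L(1), of "cross3 K e"]
      AB(1)[OF L(3), of e]
    by (simp add: L2_inner_def c_def mult.commute cross_mult_left)
  have curl2: "B c \<bullet> e = A v \<bullet> cross3 K e" for e
    using HDC0_curl_identity[OF \<Omega> C1_sin_wave v, of k e, unfolded cK] AB(1)[OF L(1), of "cross3 K e"]
      AB(2)[OF L(3), of e]
    by (simp add: L2_inner_def c_def mult.commute cross_mult_left)
  have trip: "a \<bullet> cross3 b e = e \<bullet> cross3 a b" for a b e :: "real^3"
    by (simp add: cross3_simps)
  have c1: "A c = - cross3 (B v) K"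
    by (rule vector_eq_rdot[THEN iffD1, OF allI], subst curl1) (simp add: trip inner_commute)
  have c2: "B c = cross3 (A v) K"
    by (rule vector_eq_rdot[THEN iffD1, OF allI], subst curl2) (simp add: trip inner_commute)
  have "(norm K * norm (A v))\<^sup>2 = (sin_coeff \<Omega> k d)\<^sup>2 + (norm (B c))\<^sup>2"
    "(norm K * norm (B v))\<^sup>2 = (cos_coeff \<Omega> k d)\<^sup>2 + (norm (A c))\<^sup>2"
    using norm_cross_dot[of "A v" K] norm_cross_dot[of "B v" K]
    by (simp_all add: c1 c2 div1 div2 mult.commute)
  then have "(norm K)\<^sup>2 * ((norm (A v))\<^sup>2 + (norm (B v))\<^sup>2)
      = wave_energy \<Omega> k d + ((norm (A c))\<^sup>2 + (norm (B c))\<^sup>2)"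
    by (simp add: wave_energy_def power_mult_distrib algebra_simps)
  moreover have "(norm (A u))\<^sup>2 + (norm (B u))\<^sup>2 = (\<Sum>i\<in>UNIV. wave_energy \<Omega> k (\<lambda>x. u x $ i))" for u
    unfolding power2_norm_eq_inner
    by (simp add: inner_vec_def A_def B_def wave_energy_def sum.distrib power2_eq_square)
  ultimately show ?thesis by (simp add: K_def d_def c_def)
qed

section \<open>Uniform approximation by trigonometric polynomials\<close>

definition period_box :: "real \<Rightarrow> 'a::euclidean_space set" where
  "period_box R = box (- (pi * R) *\<^sub>R One) ((pi * R) *\<^sub>R One)"

definition wave_lattice :: "real \<Rightarrow> 'a::euclidean_space set" where
  "wave_lattice R = {k. \<forall>b\<in>Basis. (k \<bullet> b) * R \<in> \<int>}"

text \<open>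
  Complex linear combinations of waves, given inductively so that closure under products needs no
  reindexing of double sums.
\<close>

inductive trig_poly :: "real \<Rightarrow> ('a::euclidean_space \<Rightarrow> complex) \<Rightarrow> bool" for R where
  monomial: "k \<in> wave_lattice R \<Longrightarrow> trig_poly R (\<lambda>x. c * cis (k \<bullet> x))"
| add: "trig_poly R p \<Longrightarrow> trig_poly R q \<Longrightarrow> trig_poly R (\<lambda>x. p x + q x)"

lemma zero_in_wave_lattice: "0 \<in> wave_lattice R"
  and wave_lattice_add: "k \<in> wave_lattice R \<Longrightarrow> l \<in> wave_lattice R \<Longrightarrow> k + l \<in> wave_lattice R"
  and wave_lattice_uminus: "k \<in> wave_lattice R \<Longrightarrow> - k \<in> wave_lattice R"
  by (auto simp: wave_lattice_def inner_simps distrib_right)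

lemma Basis_in_wave_lattice:
  assumes "R > 0" "b \<in> Basis" shows "(1 / R) *\<^sub>R b \<in> wave_lattice R"
  using assms by (auto simp: wave_lattice_def inner_Basis)

lemma trig_poly_const: "trig_poly R (\<lambda>x. c)"
  using trig_poly.monomial[OF zero_in_wave_lattice, of R c] by simp

lemma trig_poly_sum:
  "(\<And>i. i \<in> I \<Longrightarrow> trig_poly R (f i)) \<Longrightarrow> trig_poly R (\<lambda>x. \<Sum>i\<in>I. f i x)"
  by (induction I rule: infinite_finite_induct) (simp_all add: trig_poly_const trig_poly.add)

lemma trig_poly_mult:
  assumes "trig_poly R p" "trig_poly R q"
  shows "trig_poly R (\<lambda>x. p x * q x)"
  using assms
proof (induction arbitrary: q)
  case (monomial k c)
  from monomial(2) show ?case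
  proof induction
    case (monomial l d)
    have eq: "c * cis (k \<bullet> x) * (d * cis (l \<bullet> x)) = (c * d) * cis ((k + l) \<bullet> x)" for x
      by (simp add: inner_simps flip: cis_mult)
    show ?case unfolding eq
      using monomial \<open>k \<in> wave_lattice R\<close> by (intro trig_poly.monomial wave_lattice_add)
  next
    case (add p q)
    show ?case unfolding distrib_left by (rule trig_poly.add[OF add.IH])
  qed
next
  case (add p1 p2)
  show ?case unfolding distrib_right by (rule trig_poly.add) (intro add.IH add.prems)+
qed

lemma trig_poly_cos_sin:
  assumes "k \<in> wave_lattice R"
  shows "trig_poly R (\<lambda>x. complex_of_real (cos (k \<bullet> x)))" "trig_poly R (\<lambda>x. complex_of_real (sin (k \<bullet> x)))"
proof -
  have eq: "complex_of_real (cos (k \<bullet> x)) = 1/2 * cis (k \<bullet> x) + 1/2 * cis ((-k) \<bullet> x)"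
    "complex_of_real (sin (k \<bullet> x)) = (-\<i>/2) * cis (k \<bullet> x) + (\<i>/2) * cis ((-k) \<bullet> x)" for x
    by (auto simp: complex_eq_iff)
  show "trig_poly R (\<lambda>x. complex_of_real (cos (k \<bullet> x)))" "trig_poly R (\<lambda>x. complex_of_real (sin (k \<bullet> x)))"
    unfolding eq by (intro trig_poly.intros wave_lattice_uminus assms)+
qed

lemma continuous_on_trig_poly: "trig_poly R p \<Longrightarrow> continuous_on UNIV p"
proof (induction rule: trig_poly.induct)
  case (monomial k c)
  show ?case unfolding cis_conv_exp by (intro continuous_intros)
qed (intro continuous_on_add)

text \<open>
  The cube modulo periods, embedded in Euclidean space: polynomials in these coordinates are
  trigonometric polynomials.
\<close>

definition torus_map :: "real \<Rightarrow> 'a::euclidean_space \<Rightarrow> 'a \<times> 'a" where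
  "torus_map R x = (\<Sum>b\<in>Basis. cos ((1 / R) *\<^sub>R b \<bullet> x) *\<^sub>R b, \<Sum>b\<in>Basis. sin ((1 / R) *\<^sub>R b \<bullet> x) *\<^sub>R b)"

lemma trig_poly_of_torus_polynomial:
  assumes "R > 0" "real_polynomial_function p"
  shows "trig_poly R (\<lambda>x. complex_of_real (p (torus_map R x)))"
  using assms(2)
proof (induction rule: real_polynomial_function.induct)
  case (linear f)
  interpret bounded_linear f by fact
  have eq: "f (torus_map R x) = (\<Sum>b\<in>Basis. cos ((1 / R) *\<^sub>R b \<bullet> x) * f (b, 0) + sin ((1 / R) *\<^sub>R b \<bullet> x) * f (0, b))" for x
  proof -
    have "torus_map R x = (\<Sum>b\<in>Basis. cos ((1 / R) *\<^sub>R b \<bullet> x) *\<^sub>R (b, 0) + sin ((1 / R) *\<^sub>R b \<bullet> x) *\<^sub>R (0, b))"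
      by (simp add: torus_map_def prod_eq_iff fst_sum snd_sum sum.distrib)
    then show ?thesis by (simp only: sum add scaleR real_scaleR_def)
  qed
  show ?case
    unfolding eq of_real_sum of_real_add of_real_mult
    by (intro trig_poly_sum trig_poly.add trig_poly_mult trig_poly_cos_sin trig_poly_const
        Basis_in_wave_lattice assms(1))
next
  case (const c)
  show ?case by (rule trig_poly_const)
next
  case (add f g)
  show ?case unfolding of_real_add by (rule trig_poly.add[OF add.IH])
next
  case (mult f g)
  show ?case unfolding of_real_mult by (rule trig_poly_mult[OF mult.IH])
qed

lemma continuous_on_torus_map: "continuous_on S (torus_map R)"
  unfolding torus_map_def by (intro continuous_intros)

lemma cos_sin_eq_on_period:
  fixes s t :: real
  assumes "cos s = cos t" "sin s = sin t" "- pi \<le> s" "s \<le> pi" "- pi < t" "t < pi"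
  shows "s = t"
proof -
  have "sin (s - t) = 0" "cos (s - t) = 1"
    using assms(1,2) by (auto simp: sin_diff cos_diff simp flip: power2_eq_square)
  then obtain n :: int where n: "s - t = of_int n * (2 * pi)"
    by (auto simp: cos_one_2pi_int mult_ac)
  moreover have "\<bar>s - t\<bar> < 2 * pi" using assms by linarith
  ultimately have "\<bar>of_int n * (2 * pi)\<bar> < 2 * pi" by simp
  then have "\<bar>real_of_int n\<bar> < 1" by (simp add: abs_mult)
  then have "n = 0" by linarith
  then show ?thesis using n by simp
qed

lemma torus_map_inj:
  assumes "R > 0" "x \<in> cbox (- (pi * R) *\<^sub>R One) ((pi * R) *\<^sub>R One)" "y \<in> period_box R"
    "torus_map R x = torus_map R y"
  shows "x = y"
proof (rule euclidean_eqI)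
  fix b :: 'a assume b: "b \<in> Basis"
  have "cos (b \<bullet> x / R) = cos (b \<bullet> y / R)" "sin (b \<bullet> x / R) = sin (b \<bullet> y / R)"
  proof -
    have "fst (torus_map R z) \<bullet> b = cos (b \<bullet> z / R)" "snd (torus_map R z) \<bullet> b = sin (b \<bullet> z / R)" for z
      using b by (simp_all add: torus_map_def inner_sum_left_Basis)
    then show "cos (b \<bullet> x / R) = cos (b \<bullet> y / R)" "sin (b \<bullet> x / R) = sin (b \<bullet> y / R)"
      using assms(4) by metis+
  qed
  moreover have "- pi \<le> b \<bullet> x / R" "b \<bullet> x / R \<le> pi" "- pi < b \<bullet> y / R" "b \<bullet> y / R < pi"
    using assms(1-3) b by (auto simp: mem_box period_box_def field_simps inner_commute[of b x] inner_commute[of b y])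
  ultimately have "b \<bullet> x / R = b \<bullet> y / R" by (rule cos_sin_eq_on_period)
  then show "x \<bullet> b = y \<bullet> b" using assms(1) by (simp add: inner_commute)
qed

text \<open>
  A continuous function that vanishes outside the open cube takes the same value at points identified
  by \<open>torus_map\<close>: the map is injective except on the boundary. It therefore descends to a function on
  the image of the closed cube, which is continuous because a continuous map on a compact set is a
  quotient map. The Stone-Weierstrass theorem applies to that function.
\<close>

lemma trig_poly_uniformly_dense:
  fixes h :: "'a::euclidean_space \<Rightarrow> real"
  assumes R: "R > 0" and h: "continuous_on UNIV h" "\<And>x. x \<notin> period_box R \<Longrightarrow> h x = 0" and \<epsilon>: "\<epsilon> > 0"
  obtains p where "trig_poly R p" "\<And>x. x \<in> period_box R \<Longrightarrow> norm (of_real (h x) - p x) < \<epsilon>"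
proof -
  define Q :: "'a set" where "Q = cbox (- (pi * R) *\<^sub>R One) ((pi * R) *\<^sub>R One)"
  define T where "T = torus_map R ` Q"
  have eq: "h x = h y" if "x \<in> Q" "y \<in> Q" "torus_map R x = torus_map R y" for x y
    using torus_map_inj[OF R, of x y] torus_map_inj[OF R, of y x] that h(2)
    unfolding Q_def by metis
  \<comment> \<open>The function induced on the torus.\<close>
  define g where "g z = h (SOME x. x \<in> Q \<and> torus_map R x = z)" for z
  have g: "g (torus_map R x) = h x" if "x \<in> Q" for x
  proof -
    have "\<exists>y. y \<in> Q \<and> torus_map R y = torus_map R x" using that by blast
    then have "(SOME y. y \<in> Q \<and> torus_map R y = torus_map R x) \<in> Q \<and>
        torus_map R (SOME y. y \<in> Q \<and> torus_map R y = torus_map R x) = torus_map R x"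
      by (rule someI_ex)
    then show ?thesis using eq[OF _ that] by (simp add: g_def)
  qed
  have T: "compact T"
    unfolding T_def Q_def by (intro compact_continuous_image continuous_on_torus_map compact_cbox)
  have "continuous_on T g"
    unfolding continuous_on_closed_vimage[OF compact_imp_closed[OF T]]
  proof (intro allI impI)
    fix C :: "real set" assume C: "closed C"
    have "g -` C \<inter> T = torus_map R ` (Q \<inter> h -` C)"
      using g by (auto simp: T_def)
    moreover have "compact (Q \<inter> h -` C)"
      using C h(1) unfolding Q_def
      by (intro compact_Int_closed compact_cbox) (simp add: continuous_on_closed_vimage)
    ultimately show "closed (g -` C \<inter> T)"
      by (simp add: compact_imp_closed compact_continuous_image continuous_on_torus_map)
  qed
  then obtain q where q: "real_polynomial_function q" "\<And>z. z \<in> T \<Longrightarrow> \<bar>g z - q z\<bar> < \<epsilon>"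
    using Stone_Weierstrass_real_polynomial_function[OF T _ \<epsilon>] by blast
  show thesis
  proof
    show "trig_poly R (\<lambda>x. complex_of_real (q (torus_map R x)))"
      by (rule trig_poly_of_torus_polynomial[OF R q(1)])
    fix x :: 'a assume "x \<in> period_box R"
    then have "x \<in> Q" using box_subset_cbox by (auto simp: period_box_def Q_def)
    then show "norm (of_real (h x) - complex_of_real (q (torus_map R x))) < \<epsilon>"
      using q(2)[of "torus_map R x"] g by (simp add: T_def flip: of_real_diff)
  qed
qed

section \<open>Density of trigonometric polynomials among square-integrable functions\<close>

text \<open>
  Truncation reduces the approximation of square-integrable functions to bounded ones, for which
  dominated convergence on a bounded box has a constant majorant.
\<close>

lemma real_L2_approx_bounded:
  fixes f :: "'a::euclidean_space \<Rightarrow> real"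
  assumes f: "f \<in> L2 \<Omega>"
  shows "(\<lambda>m. LINT x|lebesgue_on \<Omega>. (f x - max (- real m) (min (real m) (f x)))\<^sup>2) \<longlonglongrightarrow> 0"
proof -
  have [measurable]: "f \<in> borel_measurable (lebesgue_on \<Omega>)" using f by (simp add: L2_def)
  have "(\<lambda>m. LINT x|lebesgue_on \<Omega>. (f x - max (- real m) (min (real m) (f x)))\<^sup>2)
      \<longlonglongrightarrow> (LINT x|lebesgue_on \<Omega>. 0)"
  proof (rule integral_dominated_convergence[where w = "\<lambda>x. (f x)\<^sup>2"])
    show "integrable (lebesgue_on \<Omega>) (\<lambda>x. (f x)\<^sup>2)" using f by (simp add: L2_def)
    show "AE x in lebesgue_on \<Omega>. (\<lambda>m. (f x - max (- real m) (min (real m) (f x)))\<^sup>2) \<longlonglongrightarrow> 0"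
    proof (intro AE_I2 tendsto_eventually)
      fix x
      obtain m0 where "\<bar>f x\<bar> \<le> real m0" using real_arch_simple by blast
      then have "(f x - max (- real m) (min (real m) (f x)))\<^sup>2 = 0" if "m \<ge> m0" for m
        using that by auto
      then show "\<forall>\<^sub>F m in sequentially. (f x - max (- real m) (min (real m) (f x)))\<^sup>2 = 0"
        unfolding eventually_sequentially by blast
    qed
    show "AE x in lebesgue_on \<Omega>. norm ((f x - max (- real m) (min (real m) (f x)))\<^sup>2) \<le> (f x)\<^sup>2" for m
    proof (intro AE_I2)
      fix x
      have "\<bar>f x - max (- real m) (min (real m) (f x))\<bar> \<le> \<bar>f x\<bar>" by (auto simp: max_def min_def)
      then show "norm ((f x - max (- real m) (min (real m) (f x)))\<^sup>2) \<le> (f x)\<^sup>2"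
        by (simp add: abs_le_square_iff)
    qed
  qed measurable
  then show ?thesis by simp
qed

text \<open>
  A measurable function is almost everywhere a limit of continuous functions. Truncating these at the
  bound \<open>B\<close> provides a majorant, and the factor \<open>box_bump\<close> makes them vanish outside the box without
  changing the limit inside.
\<close>

lemma bounded_approx_continuous:
  fixes f :: "'a::euclidean_space \<Rightarrow> real"
  assumes f: "f \<in> borel_measurable (lebesgue_on (box a b))" "\<And>x. \<bar>f x\<bar> \<le> B" and "\<epsilon> > 0"
  obtains h where "continuous_on UNIV h" "\<And>x. x \<notin> box a b \<Longrightarrow> h x = 0"
    "(LINT x|lebesgue_on (box a b). (f x - h x)\<^sup>2) < \<epsilon>"
proof -
  interpret finite_measure "lebesgue_on (box a b)"
    by (intro finite_measure_lebesgue_on) simp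
  have "f measurable_on (box a b)"
    using f(1) by (simp add: measurable_on_iff_borel_measurable)
  then obtain N g where N: "negligible N" and g: "\<And>n::nat. continuous_on UNIV (g n)"
    and lim: "\<And>x. x \<notin> N \<Longrightarrow> (\<lambda>n. g n x) \<longlonglongrightarrow> (if x \<in> box a b then f x else 0)"
    unfolding measurable_on_def by auto
  have B: "0 \<le> B" using f(2)[of 0] by linarith
  define h where "h n x = box_bump a b n x * max (- B) (min B (g n x))" for n x
  have ch: "continuous_on UNIV (h n)" for n
  proof -
    have "continuous_on UNIV (box_bump a b n)"
      using test_functionD(2)[OF box_bump_test_function[of a b "cbox a b" n]] by simp
    then show ?thesis unfolding h_def using g by (intro continuous_intros)
  qed
  have mh[measurable]: "h n \<in> borel_measurable (lebesgue_on (box a b))" for n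
    using ch[of n] by (intro continuous_imp_measurable_on_sets_lebesgue) (auto intro: continuous_on_subset)
  note f(1)[measurable]
  have clamp: "\<bar>max (- B) (min B t)\<bar> \<le> B" for t using B by auto
  have hB: "\<bar>h n x\<bar> \<le> B" for n x
  proof -
    have "\<bar>h n x\<bar> \<le> 1 * B"
      unfolding h_def abs_mult by (intro mult_mono clamp) (use box_bump_bounds[of a b n x] in auto)
    then show ?thesis by simp
  qed
  have "(\<lambda>n. LINT x|lebesgue_on (box a b). (f x - h n x)\<^sup>2) \<longlonglongrightarrow> (LINT x|lebesgue_on (box a b). 0)"
  proof (rule integral_dominated_convergence[where w = "\<lambda>x. (2 * B)\<^sup>2"])
    have "AE x in lebesgue. x \<notin> N"
      using N by (intro AE_not_in) (simp add: negligible_iff_null_sets)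
    then have "AE x in lebesgue_on (box a b). x \<notin> N"
      by (auto simp: AE_restrict_space_iff elim: eventually_mono)
    then show "AE x in lebesgue_on (box a b). (\<lambda>n. (f x - h n x)\<^sup>2) \<longlonglongrightarrow> 0"
    proof (rule AE_mp, intro AE_I2 impI)
      fix x assume x: "x \<in> space (lebesgue_on (box a b))" "x \<notin> N"
      then have "(\<lambda>n. (f x - h n x)\<^sup>2) \<longlonglongrightarrow> (f x - indicator (box a b) x * max (- B) (min B (f x)))\<^sup>2"
        unfolding h_def using lim[of x] by (intro tendsto_intros box_bump_tendsto) auto
      moreover have "max (- B) (min B (f x)) = f x" using f(2)[of x] by (auto simp: abs_le_iff max_def min_def)
      ultimately show "(\<lambda>n. (f x - h n x)\<^sup>2) \<longlonglongrightarrow> 0" using x by simp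
    qed
    show "AE x in lebesgue_on (box a b). norm ((f x - h n x)\<^sup>2) \<le> (2 * B)\<^sup>2" for n
    proof (intro AE_I2)
      fix x
      have "\<bar>f x - h n x\<bar> \<le> \<bar>2 * B\<bar>" using f(2)[of x] hB[of n x] by linarith
      then show "norm ((f x - h n x)\<^sup>2) \<le> (2 * B)\<^sup>2" by (simp only: abs_le_square_iff real_norm_def abs_power2)
    qed
  qed auto
  then have "(\<lambda>n. LINT x|lebesgue_on (box a b). (f x - h n x)\<^sup>2) \<longlonglongrightarrow> 0" by simp
  then have "\<forall>\<^sub>F n in sequentially. (LINT x|lebesgue_on (box a b). (f x - h n x)\<^sup>2) < \<epsilon>"
    using \<open>\<epsilon> > 0\<close> by (rule order_tendstoD)
  then obtain n where "(LINT x|lebesgue_on (box a b). (f x - h n x)\<^sup>2) < \<epsilon>"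
    by (auto simp: eventually_sequentially)
  then show thesis using that[of "h n"] ch by (auto simp: h_def box_bump_eq_0)
qed

lemma trig_poly_L2:
  assumes "trig_poly R p" shows "p \<in> L2 (period_box R)"
  by (rule L2_of_continuous) (auto simp: period_box_def continuous_on_trig_poly[OF assms])

lemma norm_add3_square_le:
  fixes a b c :: "'b::real_normed_vector"
  shows "(norm (a + b + c))\<^sup>2 \<le> 3 * (norm a)\<^sup>2 + 3 * (norm b)\<^sup>2 + 3 * (norm c)\<^sup>2"
proof -
  have "norm (a + b + c) \<le> norm a + norm b + norm c"
    using norm_triangle_ineq[of "a + b" c] norm_triangle_ineq[of a b] by linarith
  then have "(norm (a + b + c))\<^sup>2 \<le> (norm a + norm b + norm c)\<^sup>2" by (intro power_mono) auto
  also have "\<dots> \<le> 3 * (norm a)\<^sup>2 + 3 * (norm b)\<^sup>2 + 3 * (norm c)\<^sup>2"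
    using sum_squares_bound[of "norm a" "norm b"] sum_squares_bound[of "norm b" "norm c"]
      sum_squares_bound[of "norm a" "norm c"] by (simp add: power2_eq_square algebra_simps)
  finally show ?thesis .
qed

lemma trig_poly_dense_L2_real:
  fixes f :: "'a::euclidean_space \<Rightarrow> real"
  assumes R: "R > 0" and f: "f \<in> L2 (period_box R)" and \<epsilon>: "\<epsilon> > 0"
  obtains p where "trig_poly R p"
    "(LINT x|lebesgue_on (period_box R). (norm (of_real (f x) - p x))\<^sup>2) < \<epsilon>"
proof -
  let ?Q = "period_box R :: 'a set"
  let ?M = "lebesgue_on ?Q"
  interpret finite_measure ?M
    by (intro finite_measure_lebesgue_on) (simp add: period_box_def)
  have mf[measurable]: "f \<in> borel_measurable ?M" using f by (simp add: L2_def)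
  have "\<forall>\<^sub>F m in sequentially. (LINT x|?M. (f x - max (- real m) (min (real m) (f x)))\<^sup>2) < \<epsilon> / 9"
    using real_L2_approx_bounded[OF f] \<epsilon> by (intro order_tendstoD) auto
  then obtain m where m: "(LINT x|?M. (f x - max (- real m) (min (real m) (f x)))\<^sup>2) < \<epsilon> / 9"
    by (auto simp: eventually_sequentially)
  define u where "u x = max (- real m) (min (real m) (f x))" for x
  have mu[measurable]: "u \<in> borel_measurable ?M" unfolding u_def by measurable
  have uB: "\<bar>u x\<bar> \<le> real m" for x by (auto simp: u_def)
  obtain h where h: "continuous_on UNIV h" "\<And>x. x \<notin> ?Q \<Longrightarrow> h x = 0"
    "(LINT x|?M. (u x - h x)\<^sup>2) < \<epsilon> / 9"
    using bounded_approx_continuous[OF mu[unfolded period_box_def] uB, of "\<epsilon> / 9"] \<epsilon>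
    unfolding period_box_def by auto
  define V where "V = measure ?M ?Q"
  \<comment> \<open>Three errors (truncation, continuous and trigonometric approximation), each contributing at most
    \<open>3 * (\<epsilon> / 9)\<close>; adding \<open>1\<close> to the volume avoids a discussion of \<open>V = 0\<close>.\<close>
  define \<delta> where "\<delta> = sqrt (\<epsilon> / (9 * (V + 1)))"
  have V: "V \<ge> 0" by (simp add: V_def)
  have \<delta>: "\<delta> > 0" "\<delta>\<^sup>2 * V < \<epsilon> / 9"
  proof -
    show "\<delta> > 0" using \<epsilon> V by (simp add: \<delta>_def)
    have "\<delta>\<^sup>2 * V = (\<epsilon> / 9) * (V / (V + 1))" using \<epsilon> V by (simp add: \<delta>_def)
    also have "\<dots> < (\<epsilon> / 9) * 1" using \<epsilon> V by (intro mult_strict_left_mono) auto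
    finally show "\<delta>\<^sup>2 * V < \<epsilon> / 9" by simp
  qed
  obtain p where p: "trig_poly R p" "\<And>x. x \<in> ?Q \<Longrightarrow> norm (of_real (h x) - p x) < \<delta>"
    using trig_poly_uniformly_dense[OF R h(1,2) \<delta>(1)] by blast
  have L: "u \<in> L2 ?Q" "h \<in> L2 ?Q"
  proof -
    have "u x * u x \<le> real m * real m" for x
      using uB[of x] abs_le_square_iff[of "u x" "real m"] by (simp add: power2_eq_square)
    then show "u \<in> L2 ?Q"
      using mu by (auto simp: L2_def power2_eq_square intro!: integrable_const_bound[where B = "real m * real m"] AE_I2)
    show "h \<in> L2 ?Q" using h(1) by (intro L2_of_continuous) (auto simp: period_box_def)
  qed
  have i1: "integrable ?M (\<lambda>x. (f x - u x)\<^sup>2)" "integrable ?M (\<lambda>x. (u x - h x)\<^sup>2)"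
    using L2_diff[OF f L(1)] L2_diff[OF L] by (auto simp: L2_def)
  have "(LINT x|?M. (norm (of_real (f x) - p x))\<^sup>2)
      \<le> (LINT x|?M. 3 * (f x - u x)\<^sup>2 + 3 * (u x - h x)\<^sup>2 + 3 * \<delta>\<^sup>2)"
  proof (rule integral_mono')
    show "integrable ?M (\<lambda>x. 3 * (f x - u x)\<^sup>2 + 3 * (u x - h x)\<^sup>2 + 3 * \<delta>\<^sup>2)"
      using i1 by auto
    fix x assume "x \<in> space ?M"
    then have "norm (of_real (h x) - p x) \<le> \<delta>" using p(2)[of x] by simp
    then have d: "(norm (of_real (h x) - p x))\<^sup>2 \<le> \<delta>\<^sup>2" by (intro power_mono) auto
    have "of_real (f x) - p x = of_real (f x - u x) + of_real (u x - h x) + (of_real (h x) - p x)"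
      by simp
    then show "(norm (of_real (f x) - p x))\<^sup>2 \<le> 3 * (f x - u x)\<^sup>2 + 3 * (u x - h x)\<^sup>2 + 3 * \<delta>\<^sup>2"
      using norm_add3_square_le[of "complex_of_real (f x - u x)" "of_real (u x - h x)" "of_real (h x) - p x"] d
      unfolding norm_of_real by simp
  qed simp
  also have "\<dots> = 3 * (LINT x|?M. (f x - u x)\<^sup>2) + 3 * (LINT x|?M. (u x - h x)\<^sup>2) + 3 * (\<delta>\<^sup>2 * V)"
    using i1 by (simp add: V_def)
  also have "\<dots> < 3 * (\<epsilon> / 9) + 3 * (\<epsilon> / 9) + 3 * (\<epsilon> / 9)"
    using m h(3) \<delta>(2) unfolding u_def[symmetric] by linarith
  finally show thesis using that[OF p(1)] by simp
qed

lemma trig_poly_dense_L2_complex: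
  fixes f :: "'a::euclidean_space \<Rightarrow> complex"
  assumes R: "R > 0" and f: "f \<in> L2 (period_box R)" and \<epsilon>: "\<epsilon> > 0"
  obtains p where "trig_poly R p" "(LINT x|lebesgue_on (period_box R). (norm (f x - p x))\<^sup>2) < \<epsilon>"
proof -
  let ?M = "lebesgue_on (period_box R :: 'a set)"
  have [measurable]: "f \<in> borel_measurable ?M" and i: "integrable ?M (\<lambda>x. (norm (f x))\<^sup>2)"
    using f by (auto simp: L2_def)
  have L: "(\<lambda>x. Re (f x)) \<in> L2 (period_box R)" "(\<lambda>x. Im (f x)) \<in> L2 (period_box R)"
  proof -
    have "integrable ?M (\<lambda>x. (Re (f x))\<^sup>2)"
      by (rule Bochner_Integration.integrable_bound[OF i], measurable) (intro AE_I2, simp add: cmod_power2)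
    moreover have "integrable ?M (\<lambda>x. (Im (f x))\<^sup>2)"
      by (rule Bochner_Integration.integrable_bound[OF i], measurable) (intro AE_I2, simp add: cmod_power2)
    ultimately show "(\<lambda>x. Re (f x)) \<in> L2 (period_box R)" "(\<lambda>x. Im (f x)) \<in> L2 (period_box R)"
      by (simp_all add: L2_def)
  qed
  have \<epsilon>6: "\<epsilon> / 6 > 0" using \<epsilon> by simp
  obtain p where p: "trig_poly R p" "(LINT x|?M. (norm (of_real (Re (f x)) - p x))\<^sup>2) < \<epsilon> / 6"
    by (rule trig_poly_dense_L2_real[OF R L(1) \<epsilon>6])
  obtain q where q: "trig_poly R q" "(LINT x|?M. (norm (of_real (Im (f x)) - q x))\<^sup>2) < \<epsilon> / 6"
    by (rule trig_poly_dense_L2_real[OF R L(2) \<epsilon>6])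
  have of_real_L2: "(\<lambda>x. complex_of_real (g x)) \<in> L2 (period_box R)"
    if "g \<in> L2 (period_box R)" for g :: "'a \<Rightarrow> real"
    using that by (auto simp: L2_def intro: measurable_compose[OF _ borel_measurable_of_real])
  have i: "integrable ?M (\<lambda>x. (norm (of_real (Re (f x)) - p x))\<^sup>2)"
     "integrable ?M (\<lambda>x. (norm (of_real (Im (f x)) - q x))\<^sup>2)"
    using L2_diff[OF of_real_L2[OF L(1)] trig_poly_L2[OF p(1)]]
      L2_diff[OF of_real_L2[OF L(2)] trig_poly_L2[OF q(1)]]
    by (simp_all add: L2_def)
  have "(LINT x|?M. (norm (f x - (p x + \<i> * q x)))\<^sup>2)
      \<le> (LINT x|?M. 3 * (norm (of_real (Re (f x)) - p x))\<^sup>2 + 3 * (norm (of_real (Im (f x)) - q x))\<^sup>2)"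
  proof (rule integral_mono')
    show "integrable ?M (\<lambda>x. 3 * (norm (of_real (Re (f x)) - p x))\<^sup>2 + 3 * (norm (of_real (Im (f x)) - q x))\<^sup>2)"
      using i by auto
    fix x
    have e: "f x - (p x + \<i> * q x) = (of_real (Re (f x)) - p x) + \<i> * (of_real (Im (f x)) - q x) + 0"
      by (subst complex_eq[of "f x"]) (simp add: algebra_simps)
    show "(norm (f x - (p x + \<i> * q x)))\<^sup>2
      \<le> 3 * (norm (of_real (Re (f x)) - p x))\<^sup>2 + 3 * (norm (of_real (Im (f x)) - q x))\<^sup>2"
      unfolding e
      using norm_add3_square_le[of "of_real (Re (f x)) - p x" "\<i> * (of_real (Im (f x)) - q x)" 0]
      by (simp add: norm_mult)
  qed simp
  also have "\<dots> = 3 * (LINT x|?M. (norm (of_real (Re (f x)) - p x))\<^sup>2) + 3 * (LINT x|?M. (norm (of_real (Im (f x)) - q x))\<^sup>2)"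
    using i by simp
  also have "\<dots> < \<epsilon>" using p(2) q(2) by linarith
  finally show thesis
    using that[of "\<lambda>x. p x + \<i> * q x"]
      trig_poly.add[OF p(1) trig_poly_mult[OF trig_poly_const q(1)]] by blast
qed

lemma trig_poly_finite_sum:
  assumes "trig_poly R p"
  obtains F c where "finite F" "F \<subseteq> wave_lattice R" "\<And>x. p x = (\<Sum>k\<in>F. c k * cis (k \<bullet> x))"
proof -
  have "\<exists>F c. finite F \<and> F \<subseteq> wave_lattice R \<and> (\<forall>x. p x = (\<Sum>k\<in>F. c k * cis (k \<bullet> x)))"
    using assms
  proof induction
    case (monomial k c)
    then show ?case by (intro exI[of _ "{k}"] exI[of _ "\<lambda>_. c"]) simp
  next
    case (add p q)
    then obtain F c G d where
      p: "finite F" "F \<subseteq> wave_lattice R" "\<forall>x. p x = (\<Sum>k\<in>F. c k * cis (k \<bullet> x))" and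
      q: "finite G" "G \<subseteq> wave_lattice R" "\<forall>x. q x = (\<Sum>k\<in>G. d k * cis (k \<bullet> x))"
      by auto
    define c' where "c' k = (if k \<in> F then c k else 0) + (if k \<in> G then d k else 0)" for k
    have "p x + q x = (\<Sum>k\<in>F \<union> G. c' k * cis (k \<bullet> x))" for x
    proof -
      have "(\<Sum>k\<in>F. c k * cis (k \<bullet> x)) = (\<Sum>k\<in>F \<union> G. (if k \<in> F then c k else 0) * cis (k \<bullet> x))"
        "(\<Sum>k\<in>G. d k * cis (k \<bullet> x)) = (\<Sum>k\<in>F \<union> G. (if k \<in> G then d k else 0) * cis (k \<bullet> x))"
        using p(1) q(1) by (intro sum.mono_neutral_cong_left; auto)+
      then show ?thesis using p(3) q(3) by (simp add: c'_def distrib_right sum.distrib)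
    qed
    then show ?case using p q by (intro exI[of _ "F \<union> G"] exI[of _ c']) auto
  qed
  then show thesis using that by blast
qed

section \<open>Bessel's inequality and completeness for half-integer frequencies\<close>

lemma integral_wave_1d:
  fixes \<kappa> R :: real
  assumes "\<kappa> \<noteq> 0" "\<kappa> * R \<in> \<int>" "R > 0"
  shows "(LINT t|lborel. indicator {- (pi * R)<..<pi * R} t *\<^sub>R cis (\<kappa> * t)) = 0"
proof -
  define a where "a = pi * R"
  have a: "- a \<le> a" using assms by (simp add: a_def)
  have "(LBINT t=-a..a. cis (\<kappa> * t)) = cis (\<kappa> * a) / (\<i> * \<kappa>) - cis (\<kappa> * (- a)) / (\<i> * \<kappa>)"
  proof (rule interval_integral_FTC_finite)
    show "continuous_on {min (- a) a..max (- a) a} (\<lambda>t. cis (\<kappa> * t))"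
      unfolding cis_conv_exp by (intro continuous_intros)
    fix t assume "min (- a) a \<le> t" "t \<le> max (- a) a"
    have "((\<lambda>t. exp (\<i> * of_real (\<kappa> * t)) / (\<i> * \<kappa>)) has_vector_derivative exp (\<i> * of_real (\<kappa> * t)))
        (at t within {min (- a) a..max (- a) a})"
    proof -
      have "((\<lambda>z. exp (\<i> * \<kappa> * z) / (\<i> * \<kappa>)) has_field_derivative exp (\<i> * \<kappa> * of_real t)) (at (of_real t))"
        using assms(1) by (auto intro!: derivative_eq_intros)
      from has_vector_derivative_real_field[OF this] show ?thesis by (simp add: mult.assoc)
    qed
    then show "((\<lambda>t. cis (\<kappa> * t) / (\<i> * \<kappa>)) has_vector_derivative cis (\<kappa> * t)) (at t within {min (- a) a..max (- a) a})"
      unfolding cis_conv_exp .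
  qed
  also have "\<dots> = 0"
  proof -
    obtain n where n: "\<kappa> * R = of_int n" using assms(2) by (elim Ints_cases)
    then have "\<kappa> * a = pi * of_int n" by (simp add: a_def algebra_simps)
    then have "cis (\<kappa> * a) = cis (- (\<kappa> * a))" by (simp add: complex_eq_iff)
    then show ?thesis by simp
  qed
  finally show ?thesis
    using a by (simp add: interval_lebesgue_integral_def set_lebesgue_integral_def a_def)
qed

text \<open>
  The integral over the cube is a product of integrals over intervals, one of which is over whole periods
  of a non-constant wave.
\<close>

lemma integral_wave:
  fixes k :: "'a::euclidean_space"
  assumes R: "R > 0" and k: "k \<in> wave_lattice R" "k \<noteq> 0"
  shows "(LINT x|lebesgue_on (period_box R). cis (k \<bullet> x)) = 0"
proof -
  let ?Q = "period_box R :: 'a set"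
  define I where "I = {- (pi * R)<..<pi * R}"
  obtain b where b: "b \<in> Basis" "k \<bullet> b \<noteq> 0" using k(2) euclidean_all_zero_iff by blast
  have cc: "continuous_on UNIV (\<lambda>x::'b::euclidean_space. cis (l \<bullet> x))" for l
    unfolding cis_conv_exp by (intro continuous_intros)
  have mc[measurable]: "(\<lambda>x::'b::euclidean_space. cis (l \<bullet> x)) \<in> borel_measurable borel" for l
    using cc by (rule borel_measurable_continuous_onI)
  interpret product_sigma_finite "\<lambda>_. lborel :: real measure" by unfold_locales
  have [measurable]: "?Q \<in> sets borel" by (simp add: period_box_def)
  have int1: "integrable lborel (\<lambda>t. indicator I t *\<^sub>R cis (l * t))" for l
  proof -
    define J where "J = {- (pi * R)..pi * R}"
    have "integrable lborel (\<lambda>t. indicator J t *\<^sub>R cis (l * t))"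
      using cc[of l] by (intro borel_integrable_compact) (auto simp: J_def intro: continuous_on_subset)
    then have "integrable lborel (\<lambda>t. indicator I t *\<^sub>R (indicator J t *\<^sub>R cis (l * t)))"
      by (rule integrable_mult_indicator[rotated]) (simp add: I_def)
    moreover have "indicator I t *\<^sub>R (indicator J t *\<^sub>R cis (l * t)) = indicator I t *\<^sub>R cis (l * t)" for t
      by (auto simp: I_def J_def indicator_def)
    ultimately show ?thesis by (simp only:)
  qed
  have "(LINT x|lebesgue_on ?Q. cis (k \<bullet> x)) = (LINT x|lebesgue. indicator ?Q x *\<^sub>R cis (k \<bullet> x))"
    by (intro integral_restrict_space) (simp add: period_box_def)
  also have "\<dots> = (LINT x|lborel. indicator ?Q x *\<^sub>R cis (k \<bullet> x))"
    by (intro integral_completion) measurable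
  also have "\<dots> = (LINT x|distr (\<Pi>\<^sub>M b\<in>Basis. lborel) borel (\<lambda>f. \<Sum>b\<in>(Basis::'a set). f b *\<^sub>R b).
      indicator ?Q x *\<^sub>R cis (k \<bullet> x))"
    by (simp flip: lborel_eq)
  also have "\<dots> = (LINT x|(\<Pi>\<^sub>M b\<in>(Basis::'a set). lborel).
      indicator ?Q (\<Sum>b\<in>Basis. x b *\<^sub>R b) *\<^sub>R cis (k \<bullet> (\<Sum>b\<in>Basis. x b *\<^sub>R b)))"
    by (subst integral_distr) measurable
  also have "\<dots> = (LINT x|(\<Pi>\<^sub>M b\<in>(Basis::'a set). lborel). (\<Prod>b\<in>Basis. indicator I (x b) *\<^sub>R cis ((k \<bullet> b) * x b)))"
  proof (intro Bochner_Integration.integral_cong refl)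
    fix x :: "'a \<Rightarrow> real"
    have *: "(\<Sum>b\<in>Basis. x b *\<^sub>R b) \<bullet> c = x c" if "c \<in> Basis" for c :: 'a
      using that by simp
    have "indicator ?Q (\<Sum>b\<in>Basis. x b *\<^sub>R b) = (\<Prod>b\<in>(Basis::'a set). indicator I (x b) :: real)"
    proof (cases "\<forall>b\<in>(Basis::'a set). x b \<in> I")
      case True
      then have "(\<Sum>b\<in>Basis. x b *\<^sub>R b) \<in> ?Q" by (auto simp: period_box_def mem_box * I_def)
      then show ?thesis using True by simp
    next
      case False
      then obtain b :: 'a where b: "b \<in> Basis" "x b \<notin> I" by auto
      then have "(\<Sum>b\<in>Basis. x b *\<^sub>R b) \<notin> ?Q" by (auto simp: period_box_def mem_box * I_def)
      moreover have "(\<Prod>b\<in>(Basis::'a set). indicator I (x b) :: real) = 0"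
        using b by (intro prod_zero bexI[of _ b]) auto
      ultimately show ?thesis by simp
    qed
    moreover have "cis (k \<bullet> (\<Sum>b\<in>Basis. x b *\<^sub>R b)) = (\<Prod>b\<in>Basis. cis ((k \<bullet> b) * x b))"
      by (simp add: inner_sum_right cis_conv_exp sum_distrib_left exp_sum mult.commute)
    ultimately show "indicator ?Q (\<Sum>b\<in>Basis. x b *\<^sub>R b) *\<^sub>R cis (k \<bullet> (\<Sum>b\<in>Basis. x b *\<^sub>R b))
        = (\<Prod>b\<in>Basis. indicator I (x b) *\<^sub>R cis ((k \<bullet> b) * x b))"
      by (simp add: scaleR_conv_of_real prod.distrib)
  qed
  also have "\<dots> = (\<Prod>b\<in>(Basis::'a set). LINT t|lborel. indicator I t *\<^sub>R cis ((k \<bullet> b) * t))"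
    by (rule product_integral_prod) (use int1 in auto)
  also have "\<dots> = 0"
  proof (rule prod_zero)
    show "\<exists>b\<in>(Basis::'a set). (LINT t|lborel. indicator I t *\<^sub>R cis ((k \<bullet> b) * t)) = 0"
      using integral_wave_1d[of "k \<bullet> b" R] b k(1) R unfolding I_def
      by (intro bexI[of _ b]) (auto simp: wave_lattice_def)
  qed simp
  finally show ?thesis .
qed

text \<open>
  Differences of such frequencies lie in \<open>wave_lattice R\<close>, which gives orthogonality on the same cube, but
  \<open>0\<close> itself is excluded.
\<close>

definition half_lattice :: "real \<Rightarrow> 'a::euclidean_space set" where
  "half_lattice R = {k. \<forall>b\<in>Basis. (k \<bullet> b) * R - 1 / 2 \<in> \<int>}"

lemma half_lattice_diff: "k \<in> half_lattice R \<Longrightarrow> l \<in> half_lattice R \<Longrightarrow> k - l \<in> wave_lattice R"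
proof -
  assume "k \<in> half_lattice R" "l \<in> half_lattice R"
  then have "((k \<bullet> b) * R - 1 / 2) - ((l \<bullet> b) * R - 1 / 2) \<in> \<int>" if "b \<in> Basis" for b
    using that by - (rule Ints_diff; auto simp: half_lattice_def)
  then show "k - l \<in> wave_lattice R" by (simp add: wave_lattice_def inner_simps algebra_simps)
qed

lemma half_lattice_norm_ge:
  fixes k :: "'a::euclidean_space"
  assumes "R > 0" "k \<in> half_lattice R"
  shows "1 \<le> (2 * R)\<^sup>2 * (norm k)\<^sup>2"
proof -
  obtain b :: 'a where b: "b \<in> Basis" using nonempty_Basis by blast
  then obtain n where "(k \<bullet> b) * R - 1 / 2 = of_int n"
    using assms(2) unfolding half_lattice_def by (auto elim: Ints_cases)
  then have n: "2 * R * (k \<bullet> b) = of_int (2 * n + 1)" by (simp add: field_simps)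
  have "2 * n + 1 \<noteq> 0" by presburger
  then have "1 \<le> \<bar>2 * n + 1\<bar>" by linarith
  then have "1 \<le> \<bar>2 * R * (k \<bullet> b)\<bar>" unfolding n by linarith
  also have "\<dots> \<le> 2 * R * norm k"
    using assms(1) Basis_le_norm[OF b, of k] by (simp add: abs_mult)
  finally have "1\<^sup>2 \<le> (2 * R * norm k)\<^sup>2" by (intro power_mono) auto
  then show ?thesis by (simp add: power_mult_distrib)
qed

definition box_volume :: "'a::euclidean_space itself \<Rightarrow> real \<Rightarrow> real" where
  "box_volume _ R = measure lebesgue (period_box R :: 'a set)"

lemma box_volume_pos:
  assumes "R > 0" shows "0 < box_volume TYPE('a::euclidean_space) R"
proof -
  have "box_volume TYPE('a) R = (\<Prod>b\<in>(Basis::'a set). 2 * pi * R)"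
    using assms unfolding box_volume_def period_box_def
    by (simp add: measure_completion measure_lborel_box_eq inner_simps power_mult_distrib mult_ac)
  then show ?thesis using assms by (simp add: prod_pos)
qed

text \<open>
  Expanding the square: orthogonality removes all mixed terms. For the coefficients that minimise the
  right-hand side this yields Bessel's inequality, and for arbitrary ones an upper bound for the norm of
  \<open>f\<close>.
\<close>

lemma wave_sum_distance:
  fixes f :: "'a::euclidean_space \<Rightarrow> real" and c :: "'a \<Rightarrow> complex" and R :: real
  defines "M \<equiv> lebesgue_on (period_box R :: 'a set)"
  assumes R: "R > 0" and f: "f \<in> L2 (period_box R)" and F: "finite F" "F \<subseteq> half_lattice R"
  shows "(LINT x|M. (norm (of_real (f x) - (\<Sum>k\<in>F. c k * cis (k \<bullet> x))))\<^sup>2)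
    = (LINT x|M. (f x)\<^sup>2)
      - 2 * (\<Sum>k\<in>F. Re (c k * Complex (cos_coeff (period_box R) k f) (sin_coeff (period_box R) k f)))
      + box_volume TYPE('a) R * (\<Sum>k\<in>F. (norm (c k))\<^sup>2)"
proof -
  let ?Q = "period_box R :: 'a set"
  have Q: "open ?Q" "bounded ?Q" "?Q \<in> sets lebesgue" by (auto simp: period_box_def)
  have cc: "continuous_on UNIV (\<lambda>x::'a. cis (l \<bullet> x))" for l
    unfolding cis_conv_exp by (intro continuous_intros)
  define p where "p x = (\<Sum>k\<in>F. c k * cis (k \<bullet> x))" for x
  have cp: "continuous_on UNIV p" unfolding p_def by (intro continuous_intros cc)
  have i0: "integrable M (\<lambda>x. (f x)\<^sup>2)" using f by (simp add: L2_def M_def)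
  have icos: "integrable M (\<lambda>x. f x * cos (k \<bullet> x))" and isin: "integrable M (\<lambda>x. f x * sin (k \<bullet> x))" for k
  proof -
    have "continuous_on UNIV (\<lambda>x::'a. cos (k \<bullet> x))" "continuous_on UNIV (\<lambda>x::'a. sin (k \<bullet> x))"
      by (intro continuous_intros)+
    from this[THEN L2_of_continuous[OF Q(1,2)], THEN L2_inner_integrable[OF f]]
    show "integrable M (\<lambda>x. f x * cos (k \<bullet> x))" "integrable M (\<lambda>x. f x * sin (k \<bullet> x))"
      by (simp_all add: M_def)
  qed
  have i2: "integrable M (\<lambda>x. (norm (p x))\<^sup>2)"
    using L2_of_continuous[OF Q(1,2) cp] by (simp add: L2_def M_def)
  have eq: "(norm (of_real (f x) - p x))\<^sup>2
      = (f x)\<^sup>2 - 2 * (\<Sum>k\<in>F. Re (c k) * (f x * cos (k \<bullet> x)) - Im (c k) * (f x * sin (k \<bullet> x))) + (norm (p x))\<^sup>2" for x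
  proof -
    have "(norm (of_real (f x) - p x))\<^sup>2 = (f x)\<^sup>2 - 2 * (f x * Re (p x)) + (norm (p x))\<^sup>2"
      unfolding cmod_power2 by (simp add: power2_eq_square algebra_simps)
    also have "f x * Re (p x) = (\<Sum>k\<in>F. Re (c k) * (f x * cos (k \<bullet> x)) - Im (c k) * (f x * sin (k \<bullet> x)))"
      by (simp add: p_def sum_distrib_left algebra_simps)
    finally show ?thesis .
  qed
  have "(LINT x|M. (norm (of_real (f x) - p x))\<^sup>2) = (LINT x|M. (f x)\<^sup>2)
     - 2 * (\<Sum>k\<in>F. Re (c k) * cos_coeff ?Q k f - Im (c k) * sin_coeff ?Q k f) + (LINT x|M. (norm (p x))\<^sup>2)"
    unfolding eq cos_coeff_def sin_coeff_def M_def[symmetric]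
    using i0 icos isin i2 by simp
  also have "(LINT x|M. (norm (p x))\<^sup>2) = box_volume TYPE('a) R * (\<Sum>k\<in>F. (norm (c k))\<^sup>2)"
  proof -
    have ic: "integrable M (\<lambda>x. cis (l \<bullet> x))" for l
      unfolding M_def by (rule L2_integrable[OF L2_of_continuous[OF Q(1,2) cc] Q(2,3)])
    have e: "complex_of_real ((norm (p x))\<^sup>2) = (\<Sum>k\<in>F. \<Sum>l\<in>F. c k * cnj (c l) * cis ((k - l) \<bullet> x))" for x
    proof -
      have "complex_of_real ((norm (p x))\<^sup>2) = p x * cnj (p x)" by (rule complex_norm_square)
      also have "\<dots> = (\<Sum>k\<in>F. \<Sum>l\<in>F. (c k * cis (k \<bullet> x)) * cnj (c l * cis (l \<bullet> x)))"
        by (simp only: p_def cnj_sum sum_product)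
      also have "\<dots> = (\<Sum>k\<in>F. \<Sum>l\<in>F. c k * cnj (c l) * cis ((k - l) \<bullet> x))"
      proof (intro sum.cong refl)
        fix k l
        have "cis ((k - l) \<bullet> x) = cis (k \<bullet> x) * cnj (cis (l \<bullet> x))"
          by (simp add: inner_diff_left cis_cnj cis_mult)
        then show "(c k * cis (k \<bullet> x)) * cnj (c l * cis (l \<bullet> x)) = c k * cnj (c l) * cis ((k - l) \<bullet> x)"
          by (simp only: complex_cnj_mult mult_ac)
      qed
      finally show ?thesis .
    qed
    have o: "(LINT x|M. cis ((k - l) \<bullet> x)) = (if k = l then of_real (box_volume TYPE('a) R) else 0)"
      if "k \<in> F" "l \<in> F" for k l
    proof (cases "k = l")
      case True
      then show ?thesis
        using Q by (simp add: M_def box_volume_def measure_restrict_space scaleR_conv_of_real)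
    next
      case False
      then show ?thesis
        using integral_wave[OF R half_lattice_diff, of k l] that F by (auto simp: M_def)
    qed
    have "complex_of_real (LINT x|M. (norm (p x))\<^sup>2) = (LINT x|M. complex_of_real ((norm (p x))\<^sup>2))"
      by (simp del: of_real_power)
    also have "\<dots> = (\<Sum>k\<in>F. \<Sum>l\<in>F. c k * cnj (c l) * (LINT x|M. cis ((k - l) \<bullet> x)))"
      unfolding e using ic by simp
    also have "\<dots> = (\<Sum>k\<in>F. \<Sum>l\<in>F. if k = l then c k * cnj (c l) * of_real (box_volume TYPE('a) R) else 0)"
      using o by (intro sum.cong refl) auto
    also have "\<dots> = of_real (box_volume TYPE('a) R * (\<Sum>k\<in>F. (norm (c k))\<^sup>2))"
      using F(1) by (simp add: sum_distrib_left complex_norm_square[symmetric] mult.commute del: of_real_power)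
    finally show ?thesis unfolding of_real_eq_iff .
  qed
  finally show ?thesis by (simp add: p_def)
qed

lemma wave_energy_eq_cmod:
  "wave_energy \<Omega> k f = (norm (Complex (cos_coeff \<Omega> k f) (sin_coeff \<Omega> k f)))\<^sup>2"
  by (simp add: wave_energy_def cmod_power2)

lemma wave_bessel:
  fixes f :: "'a::euclidean_space \<Rightarrow> real"
  assumes R: "R > 0" and f: "f \<in> L2 (period_box R)" and F: "finite F" "F \<subseteq> half_lattice R"
  shows "(\<Sum>k\<in>F. wave_energy (period_box R) k f)
    \<le> box_volume TYPE('a) R * (LINT x|lebesgue_on (period_box R). (f x)\<^sup>2)"
proof -
  let ?V = "box_volume TYPE('a) R"
  define z where "z k = Complex (cos_coeff (period_box R) k f) (sin_coeff (period_box R) k f)" for k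
  have V: "?V > 0" by (rule box_volume_pos[OF R])
  have t: "Re (cnj (z k) / ?V * z k) = (norm (z k))\<^sup>2 / ?V" "(norm (cnj (z k) / ?V))\<^sup>2 = (norm (z k))\<^sup>2 / ?V\<^sup>2" for k
  proof -
    have "cnj (z k) / ?V * z k = of_real ((norm (z k))\<^sup>2 / ?V)"
      by (simp only: of_real_divide complex_norm_square) (simp add: mult.commute)
    then show "Re (cnj (z k) / ?V * z k) = (norm (z k))\<^sup>2 / ?V" by (simp only: Re_complex_of_real)
    show "(norm (cnj (z k) / ?V))\<^sup>2 = (norm (z k))\<^sup>2 / ?V\<^sup>2" by (simp add: norm_divide power_divide)
  qed
  have "0 \<le> (LINT x|lebesgue_on (period_box R). (norm (of_real (f x) - (\<Sum>k\<in>F. cnj (z k) / ?V * cis (k \<bullet> x))))\<^sup>2)"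
    by simp
  also have "\<dots> = (LINT x|lebesgue_on (period_box R). (f x)\<^sup>2)
      - 2 * (\<Sum>k\<in>F. Re (cnj (z k) / ?V * z k)) + ?V * (\<Sum>k\<in>F. (norm (cnj (z k) / ?V))\<^sup>2)"
    unfolding z_def by (rule wave_sum_distance[OF R f F])
  also have "\<dots> = (LINT x|lebesgue_on (period_box R). (f x)\<^sup>2) - (\<Sum>k\<in>F. (norm (z k))\<^sup>2) / ?V"
    using V unfolding t by (simp add: power2_eq_square flip: sum_divide_distrib)
  finally show ?thesis
    using V by (simp add: wave_energy_eq_cmod z_def[symmetric] field_simps)
qed

text \<open>
  Multiplication by the wave of frequency \<open>- s\<close>, with all coordinates of \<open>s\<close> equal to \<open>1 / (2 * R)\<close>,
  carries half-integer frequencies to integer ones, where trigonometric polynomials are dense. The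
  coefficients of the approximating sum need not be the Fourier coefficients of \<open>f\<close>: by the inequality
  \<open>2 V Re (d z) \<le> V\<^sup>2 (norm d)\<^sup>2 + (norm z)\<^sup>2\<close> any coefficients \<open>d\<close> bound the norm of \<open>f\<close> by its energies
  \<open>(norm z)\<^sup>2\<close> and the distance to the sum; here \<open>V\<close> is the volume of the cube.
\<close>

lemma wave_energy_complete:
  fixes f :: "'a::euclidean_space \<Rightarrow> real"
  assumes R: "R > 0" and f: "f \<in> L2 (period_box R)" and \<epsilon>: "\<epsilon> > 0"
  obtains F where "finite F" "F \<subseteq> half_lattice R"
    "box_volume TYPE('a) R * (LINT x|lebesgue_on (period_box R). (f x)\<^sup>2)
      \<le> (\<Sum>k\<in>F. wave_energy (period_box R) k f) + \<epsilon>"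
proof -
  let ?V = "box_volume TYPE('a) R"
  let ?M = "lebesgue_on (period_box R :: 'a set)"
  have V: "?V > 0" by (rule box_volume_pos[OF R])
  define s :: 'a where "s = (1 / (2 * R)) *\<^sub>R One"
  define g where "g x = of_real (f x) * cis (- (s \<bullet> x))" for x
  have "g \<in> L2 (period_box R)"
  proof -
    have "continuous_on UNIV (\<lambda>x::'a. cis (- (s \<bullet> x)))"
      unfolding cis_conv_exp by (intro continuous_intros)
    then have "(\<lambda>x. cis (- (s \<bullet> x))) \<in> borel_measurable ?M"
      by (intro continuous_imp_measurable_on_sets_lebesgue) (auto simp: period_box_def intro: continuous_on_subset)
    then have "g \<in> borel_measurable ?M"
      using f unfolding g_def
      by (intro borel_measurable_times measurable_compose[OF _ borel_measurable_of_real]) (auto simp: L2_def)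
    then show ?thesis using f by (simp add: L2_def g_def norm_mult)
  qed
  moreover have "\<epsilon> / ?V > 0" using \<epsilon> V by simp
  ultimately obtain p where p: "trig_poly R p" "(LINT x|?M. (norm (g x - p x))\<^sup>2) < \<epsilon> / ?V"
    using trig_poly_dense_L2_complex[OF R] by blast
  obtain F0 c where F0: "finite F0" "F0 \<subseteq> wave_lattice R" "\<And>x. p x = (\<Sum>k\<in>F0. c k * cis (k \<bullet> x))"
    using trig_poly_finite_sum[OF p(1)] by blast
  define F where "F = (\<lambda>k. k + s) ` F0"
  define d where "d k = c (k - s)" for k
  have F: "finite F" "F \<subseteq> half_lattice R"
  proof -
    show "F \<subseteq> half_lattice R"
      using F0(2) R by (auto simp: F_def half_lattice_def wave_lattice_def s_def inner_simps distrib_right)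
  qed (simp add: F_def F0)
  have "norm (of_real (f x) - (\<Sum>k\<in>F. d k * cis (k \<bullet> x))) = norm (g x - p x)" for x
  proof -
    have "(\<Sum>k\<in>F. d k * cis (k \<bullet> x)) = (\<Sum>k\<in>F0. c k * cis ((k + s) \<bullet> x))"
      unfolding F_def by (subst sum.reindex) (auto simp: d_def)
    also have "\<dots> = cis (s \<bullet> x) * p x"
      by (simp add: F0(3) sum_distrib_left inner_simps mult_ac flip: cis_mult)
    finally have "of_real (f x) - (\<Sum>k\<in>F. d k * cis (k \<bullet> x)) = cis (s \<bullet> x) * (g x - p x)"
      by (simp add: g_def algebra_simps cis_mult)
    then show ?thesis by (simp add: norm_mult)
  qed
  then have "(LINT x|?M. (norm (of_real (f x) - (\<Sum>k\<in>F. d k * cis (k \<bullet> x))))\<^sup>2) < \<epsilon> / ?V"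
    using p(2) by simp
  then have D: "?V * (LINT x|?M. (norm (of_real (f x) - (\<Sum>k\<in>F. d k * cis (k \<bullet> x))))\<^sup>2) < \<epsilon>"
    using V by (simp add: field_simps)
  define z where "z k = Complex (cos_coeff (period_box R) k f) (sin_coeff (period_box R) k f)" for k
  have t: "2 * ?V * Re (d k * z k) \<le> ?V\<^sup>2 * (norm (d k))\<^sup>2 + (norm (z k))\<^sup>2" for k
  proof -
    have "Re (d k * z k) \<le> norm (d k) * norm (z k)"
      using complex_Re_le_cmod[of "d k * z k"] by (simp add: norm_mult)
    then have "2 * ?V * Re (d k * z k) \<le> 2 * (?V * norm (d k)) * norm (z k)"
      using V by (simp add: mult.assoc)
    also have "\<dots> \<le> (?V * norm (d k))\<^sup>2 + (norm (z k))\<^sup>2" by (rule sum_squares_bound)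
    finally show ?thesis by (simp add: power_mult_distrib)
  qed
  have "(\<Sum>k\<in>F. 2 * ?V * Re (d k * z k)) \<le> (\<Sum>k\<in>F. ?V\<^sup>2 * (norm (d k))\<^sup>2 + (norm (z k))\<^sup>2)"
    using t by (rule sum_mono)
  then have S: "2 * ?V * (\<Sum>k\<in>F. Re (d k * z k)) \<le> ?V * (?V * (\<Sum>k\<in>F. (norm (d k))\<^sup>2)) + (\<Sum>k\<in>F. (norm (z k))\<^sup>2)"
    by (simp add: sum.distrib sum_distrib_left power2_eq_square mult.assoc)
  have "(LINT x|?M. (f x)\<^sup>2) = (LINT x|?M. (norm (of_real (f x) - (\<Sum>k\<in>F. d k * cis (k \<bullet> x))))\<^sup>2)
      + 2 * (\<Sum>k\<in>F. Re (d k * z k)) - ?V * (\<Sum>k\<in>F. (norm (d k))\<^sup>2)"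
    unfolding wave_sum_distance[OF R f F] z_def by simp
  then have "?V * (LINT x|?M. (f x)\<^sup>2) = ?V * (LINT x|?M. (norm (of_real (f x) - (\<Sum>k\<in>F. d k * cis (k \<bullet> x))))\<^sup>2)
      + 2 * ?V * (\<Sum>k\<in>F. Re (d k * z k)) - ?V * (?V * (\<Sum>k\<in>F. (norm (d k))\<^sup>2))"
    by (simp only: distrib_left right_diff_distrib mult.assoc mult.left_commute)
  also have "\<dots> \<le> (\<Sum>k\<in>F. (norm (z k))\<^sup>2) + \<epsilon>" using S D by linarith
  finally show thesis using that[OF F] by (simp add: wave_energy_eq_cmod z_def)
qed

section \<open>The Poincare-Friedrichs inequality\<close>

lemma extension_by_zero:
  fixes f :: "'a::euclidean_space \<Rightarrow> real"
  assumes \<Omega>: "open \<Omega>" "\<Omega> \<subseteq> period_box R" and f: "f \<in> L2 \<Omega>"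
  defines "f0 \<equiv> (\<lambda>x. if x \<in> \<Omega> then f x else 0)"
  shows "f0 \<in> L2 (period_box R)"
    and "(LINT x|lebesgue_on (period_box R). (f0 x)\<^sup>2) = (LINT x|lebesgue_on \<Omega>. (f x)\<^sup>2)"
    and "wave_energy (period_box R) k f0 = wave_energy \<Omega> k f"
proof -
  have S: "\<Omega> \<in> sets lebesgue" "period_box R \<in> sets lebesgue"
    using \<Omega> by (auto simp: period_box_def)
  have sq: "(\<lambda>x. (f0 x)\<^sup>2) = (\<lambda>x. if x \<in> \<Omega> then (f x)\<^sup>2 else 0)"
    by (auto simp: f0_def)
  have "f0 \<in> borel_measurable (lebesgue_on (period_box R))"
    using f S \<Omega> unfolding f0_def by (subst borel_measurable_if_lebesgue_on) (auto simp: L2_def)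
  moreover have "integrable (lebesgue_on (period_box R)) (\<lambda>x. (f0 x)\<^sup>2)"
  proof -
    have "integrable lebesgue (\<lambda>x. if x \<in> \<Omega> then (f x)\<^sup>2 else 0)"
      using f S by (simp add: Lebesgue_Measure.integrable_restrict_UNIV L2_def)
    moreover have "(if x \<in> \<Omega> then (f x)\<^sup>2 else 0) = (if x \<in> period_box R then (if x \<in> \<Omega> then (f x)\<^sup>2 else 0) else 0)" for x
      using \<Omega> by auto
    ultimately have "integrable lebesgue (\<lambda>x. if x \<in> period_box R then (if x \<in> \<Omega> then (f x)\<^sup>2 else 0) else 0)"
      by (simp only:)
    then show ?thesis unfolding sq Lebesgue_Measure.integrable_restrict_UNIV[OF S(2)] .
  qed
  ultimately show "f0 \<in> L2 (period_box R)" by (simp add: L2_def)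
  show "(LINT x|lebesgue_on (period_box R). (f0 x)\<^sup>2) = (LINT x|lebesgue_on \<Omega>. (f x)\<^sup>2)"
    unfolding sq by (rule Lebesgue_Measure.integral_restrict[OF \<Omega>(2) S])
  have "cos_coeff (period_box R) k f0 = cos_coeff \<Omega> k f" "sin_coeff (period_box R) k f0 = sin_coeff \<Omega> k f"
    unfolding cos_coeff_def sin_coeff_def f0_def
    by (subst Lebesgue_Measure.integral_restrict[OF \<Omega>(2) S, symmetric],
        intro Bochner_Integration.integral_cong, auto)+
  then show "wave_energy (period_box R) k f0 = wave_energy \<Omega> k f"
    by (simp add: wave_energy_def)
qed

lemma L2_norm_square: "(L2_norm \<Omega> f)\<^sup>2 = (LINT x|lebesgue_on \<Omega>. (norm (f x))\<^sup>2)"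
  by (simp add: L2_norm_def L2_inner_def power2_norm_eq_inner)

lemma L2_norm_square_components:
  fixes v :: "'a::euclidean_space \<Rightarrow> real^'n"
  assumes "v \<in> L2 \<Omega>"
  shows "(L2_norm \<Omega> v)\<^sup>2 = (\<Sum>i\<in>UNIV. (L2_norm \<Omega> (\<lambda>x. v x $ i))\<^sup>2)"
proof -
  have "integrable (lebesgue_on \<Omega>) (\<lambda>x. (v x $ i)\<^sup>2)" for i
    using L2_component[OF assms, of i] by (simp add: L2_def)
  then show ?thesis
    unfolding L2_norm_square power2_norm_eq_inner[where 'a="real^'n"] inner_vec_def
    by (subst Bochner_Integration.integral_sum[symmetric]) (simp_all add: power2_eq_square)
qed

text \<open>
  The balance of energies holds for every single frequency, and on the half-integer lattice the factor
  \<open>(norm k)\<^sup>2\<close> is at least \<open>1 / (2 * R)\<^sup>2\<close>. Completeness, up to \<open>\<epsilon>\<close>, recovers the norm of \<open>v\<close> from finitely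
  many frequencies, and Bessel's inequality bounds their contributions for the divergence and curl.
\<close>

lemma HDC0_poincare:
  fixes P :: "real^3 \<Rightarrow> 'a::euclidean_space"
  assumes \<Omega>: "open \<Omega>" "\<Omega> \<subseteq> period_box R" and R: "R > 0"
    and P: "\<And>k. norm (\<chi> i. k \<bullet> P (axis i 1) :: real^3) = norm k"
    and v: "v \<in> HDC0 P \<Omega>"
  shows "(L2_norm \<Omega> v)\<^sup>2
    \<le> (2 * R)\<^sup>2 * ((L2_norm \<Omega> (weak_div P \<Omega> v))\<^sup>2 + (L2_norm \<Omega> (weak_curl P \<Omega> v))\<^sup>2)"
proof -
  let ?V = "box_volume TYPE('a) R"
  define d c where "d = weak_div P \<Omega> v" and "c = weak_curl P \<Omega> v"
  have b: "bounded \<Omega>" using \<Omega>(2) bounded_box unfolding period_box_def by (rule bounded_subset[rotated])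
  have L: "v \<in> L2 \<Omega>" "d \<in> L2 \<Omega>" "c \<in> L2 \<Omega>" using HDC0_D[OF v] by (auto simp: d_def c_def)
  have V: "?V > 0" by (rule box_volume_pos[OF R])
  have bessel: "(\<Sum>k\<in>F. wave_energy \<Omega> k f) \<le> ?V * (L2_norm \<Omega> f)\<^sup>2"
    if "f \<in> L2 \<Omega>" "finite F" "F \<subseteq> half_lattice R" for f :: "'a \<Rightarrow> real" and F
    using wave_bessel[OF R extension_by_zero(1)[OF \<Omega> that(1)] that(2,3)]
    unfolding extension_by_zero(2,3)[OF \<Omega> that(1)] L2_norm_square by simp
  have "?V * (L2_norm \<Omega> v)\<^sup>2 \<le> ?V * ((2 * R)\<^sup>2 * ((L2_norm \<Omega> d)\<^sup>2 + (L2_norm \<Omega> c)\<^sup>2)) + \<epsilon>"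
    if \<epsilon>: "\<epsilon> > 0" for \<epsilon>
  proof -
    have "\<exists>F. finite F \<and> F \<subseteq> half_lattice R \<and>
        ?V * (L2_norm \<Omega> (\<lambda>x. v x $ i))\<^sup>2 \<le> (\<Sum>k\<in>F. wave_energy \<Omega> k (\<lambda>x. v x $ i)) + \<epsilon> / 3" for i
    proof -
      note Lc = L2_component[OF L(1), of i]
      have "\<epsilon> / 3 > 0" using \<epsilon> by simp
      from wave_energy_complete[OF R extension_by_zero(1)[OF \<Omega> Lc] this]
      show ?thesis unfolding extension_by_zero(2,3)[OF \<Omega> Lc] L2_norm_square by auto
    qed
    then obtain G where G: "\<And>i. finite (G i)" "\<And>i. G i \<subseteq> half_lattice R"
      "\<And>i. ?V * (L2_norm \<Omega> (\<lambda>x. v x $ i))\<^sup>2 \<le> (\<Sum>k\<in>G i. wave_energy \<Omega> k (\<lambda>x. v x $ i)) + \<epsilon> / 3"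
      by metis
    define F where "F = (\<Union>i. G i)"
    have F: "finite F" "F \<subseteq> half_lattice R" using G by (auto simp: F_def)
    have "?V * (L2_norm \<Omega> v)\<^sup>2 = (\<Sum>i\<in>UNIV. ?V * (L2_norm \<Omega> (\<lambda>x. v x $ i))\<^sup>2)"
      by (simp add: L2_norm_square_components[OF L(1)] sum_distrib_left)
    also have "\<dots> \<le> (\<Sum>i\<in>UNIV. (\<Sum>k\<in>F. wave_energy \<Omega> k (\<lambda>x. v x $ i)) + \<epsilon> / 3)"
    proof (rule sum_mono)
      fix i :: 3
      have "(\<Sum>k\<in>G i. wave_energy \<Omega> k (\<lambda>x. v x $ i)) \<le> (\<Sum>k\<in>F. wave_energy \<Omega> k (\<lambda>x. v x $ i))"
        using F(1) by (intro sum_mono2) (auto simp: F_def wave_energy_def)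
      then show "?V * (L2_norm \<Omega> (\<lambda>x. v x $ i))\<^sup>2 \<le> (\<Sum>k\<in>F. wave_energy \<Omega> k (\<lambda>x. v x $ i)) + \<epsilon> / 3"
        using G(3)[of i] by linarith
    qed
    also have "\<dots> = (\<Sum>k\<in>F. \<Sum>i\<in>UNIV. wave_energy \<Omega> k (\<lambda>x. v x $ i)) + \<epsilon>"
      by (subst sum.swap) (simp add: sum.distrib)
    also have "(\<Sum>k\<in>F. \<Sum>i\<in>UNIV. wave_energy \<Omega> k (\<lambda>x. v x $ i))
        \<le> (\<Sum>k\<in>F. (2 * R)\<^sup>2 * (wave_energy \<Omega> k d + (\<Sum>i\<in>UNIV. wave_energy \<Omega> k (\<lambda>x. c x $ i))))"
    proof (rule sum_mono)
      fix k assume "k \<in> F"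
      then have "1 \<le> (2 * R)\<^sup>2 * (norm k)\<^sup>2" using half_lattice_norm_ge[OF R] F by blast
      then have "1 * (\<Sum>i\<in>UNIV. wave_energy \<Omega> k (\<lambda>x. v x $ i))
          \<le> ((2 * R)\<^sup>2 * (norm k)\<^sup>2) * (\<Sum>i\<in>UNIV. wave_energy \<Omega> k (\<lambda>x. v x $ i))"
        by (intro mult_right_mono sum_nonneg) (auto simp: wave_energy_def)
      then show "(\<Sum>i\<in>UNIV. wave_energy \<Omega> k (\<lambda>x. v x $ i))
          \<le> (2 * R)\<^sup>2 * (wave_energy \<Omega> k d + (\<Sum>i\<in>UNIV. wave_energy \<Omega> k (\<lambda>x. c x $ i)))"
        using HDC0_wave_energy_balance[OF \<Omega>(1) b v, of k]
        by (simp only: P d_def[symmetric] c_def[symmetric] mult_1 mult.assoc)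
    qed
    also have "\<dots> = (2 * R)\<^sup>2 * ((\<Sum>k\<in>F. wave_energy \<Omega> k d) + (\<Sum>i\<in>UNIV. \<Sum>k\<in>F. wave_energy \<Omega> k (\<lambda>x. c x $ i)))"
      using sum.swap[of "\<lambda>k i. wave_energy \<Omega> k (\<lambda>x. c x $ i)" "UNIV :: 3 set" F]
      by (simp add: sum.distrib flip: sum_distrib_left)
    also have "\<dots> \<le> (2 * R)\<^sup>2 * (?V * (L2_norm \<Omega> d)\<^sup>2 + (\<Sum>i\<in>UNIV. ?V * (L2_norm \<Omega> (\<lambda>x. c x $ i))\<^sup>2))"
      using bessel[OF L(2) F] bessel[OF L2_component[OF L(3)] F]
      by (intro mult_left_mono add_mono sum_mono) auto
    also have "\<dots> = ?V * ((2 * R)\<^sup>2 * ((L2_norm \<Omega> d)\<^sup>2 + (L2_norm \<Omega> c)\<^sup>2))"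
      by (simp add: L2_norm_square_components[OF L(3)] algebra_simps flip: sum_distrib_left)
    finally show ?thesis by simp
  qed
  then have "?V * (L2_norm \<Omega> v)\<^sup>2 \<le> ?V * ((2 * R)\<^sup>2 * ((L2_norm \<Omega> d)\<^sup>2 + (L2_norm \<Omega> c)\<^sup>2))"
    by (rule field_le_epsilon)
  then show ?thesis using V by (simp add: d_def c_def)
qed

lemma bounded_subset_period_box:
  fixes \<Omega> :: "'a::euclidean_space set"
  assumes "bounded \<Omega>"
  obtains R where "R > 0" "\<Omega> \<subseteq> period_box R"
proof -
  obtain r where r: "r > 0" "\<And>x. x \<in> \<Omega> \<Longrightarrow> norm x \<le> r"
    using assms bounded_pos by metis
  have "\<Omega> \<subseteq> period_box r"
  proof
    fix x assume "x \<in> \<Omega>"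
    have "\<bar>x \<bullet> b\<bar> < pi * r" if "b \<in> Basis" for b
    proof -
      have "\<bar>x \<bullet> b\<bar> \<le> 1 * r" using r(2)[OF \<open>x \<in> \<Omega>\<close>] Basis_le_norm[OF that, of x] by simp
      also have "\<dots> < pi * r" using r(1) pi_gt3 by (intro mult_strict_right_mono) auto
      finally show ?thesis .
    qed
    then show "x \<in> period_box r" by (fastforce simp: period_box_def mem_box abs_less_iff)
  qed
  with r(1) show thesis by (rule that)
qed

section \<open>Coercivity\<close>

text \<open>
  The integral with \<open>lam\<close> is non-negative also when the integrand is not integrable: it is then zero by
  convention.
\<close>

lemma frank_form_equal_constants_ge:
  assumes "K2 / K3 = 1" "AE x in lebesgue_on \<Omega>. 0 \<le> lam x"
  shows "K1 * (L2_norm \<Omega> (weak_div P \<Omega> v))\<^sup>2 + K3 * (L2_norm \<Omega> (weak_curl P \<Omega> v))\<^sup>2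
    \<le> frank_form P \<Omega> K1 K2 K3 n lam v v"
proof -
  have K: "K2 = K3" using assms(1) by (auto simp: divide_eq_1_iff)
  have Z: "Zmat 1 w *v u = u" for w u :: "real^3" by (simp add: Zmat_def)
  have "0 \<le> (LINT x|lebesgue_on \<Omega>. lam x * (v x \<bullet> v x))"
    by (rule integral_nonneg_AE) (use assms(2) in \<open>auto elim!: eventually_mono\<close>)
  moreover have "(L2_norm \<Omega> f)\<^sup>2 = L2_inner \<Omega> f f" for f :: "'a \<Rightarrow> 'b::euclidean_space"
    by (simp add: L2_norm_square L2_inner_def power2_norm_eq_inner)
  ultimately show ?thesis
    using assms(1) by (simp add: frank_form_def Let_def K Z L2_norm_def L2_inner_def)
qed

lemma frank_form_coercive:
  fixes P :: "real^3 \<Rightarrow> 'a::euclidean_space"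
  assumes K: "K1 > 0" "K3 > 0" "K2 / K3 = 1"
    and \<Omega>: "open \<Omega>" "bounded \<Omega>" and lam: "AE x in lebesgue_on \<Omega>. 0 \<le> lam x"
    and P: "\<And>k. norm (\<chi> i. k \<bullet> P (axis i 1) :: real^3) = norm k"
  shows "\<exists>\<alpha>\<^sub>0>0. \<forall>v\<in>HDC0 P \<Omega>. \<alpha>\<^sub>0 * (norm_DC P \<Omega> v)\<^sup>2 \<le> frank_form P \<Omega> K1 K2 K3 n lam v v"
proof -
  obtain R where R: "R > 0" "\<Omega> \<subseteq> period_box R" by (rule bounded_subset_period_box[OF \<Omega>(2)])
  define \<alpha>\<^sub>0 where "\<alpha>\<^sub>0 = min K1 K3 / ((2 * R)\<^sup>2 + 1)"
  have D: "(2 * R)\<^sup>2 + 1 > 0" using R by (simp add: add_pos_nonneg)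
  have pos: "\<alpha>\<^sub>0 > 0" unfolding \<alpha>\<^sub>0_def using K D by (intro divide_pos_pos) auto
  have "\<alpha>\<^sub>0 * (norm_DC P \<Omega> v)\<^sup>2 \<le> frank_form P \<Omega> K1 K2 K3 n lam v v" if v: "v \<in> HDC0 P \<Omega>" for v
  proof -
    define D C where "D = (L2_norm \<Omega> (weak_div P \<Omega> v))\<^sup>2" and "C = (L2_norm \<Omega> (weak_curl P \<Omega> v))\<^sup>2"
    have nn: "0 \<le> D" "0 \<le> C" by (auto simp: D_def C_def)
    have "(norm_DC P \<Omega> v)\<^sup>2 = (L2_norm \<Omega> v)\<^sup>2 + D + C"
      by (simp add: norm_DC_def D_def C_def)
    also have "\<dots> \<le> ((2 * R)\<^sup>2 + 1) * (D + C)"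
      using HDC0_poincare[OF \<Omega>(1) R(2,1) P v] by (simp add: D_def C_def algebra_simps)
    finally have "\<alpha>\<^sub>0 * (norm_DC P \<Omega> v)\<^sup>2 \<le> \<alpha>\<^sub>0 * (((2 * R)\<^sup>2 + 1) * (D + C))"
      using pos by (intro mult_left_mono) auto
    also have "\<dots> = min K1 K3 * D + min K1 K3 * C"
      using D by (simp add: \<alpha>\<^sub>0_def field_simps)
    also have "\<dots> \<le> K1 * D + K3 * C"
      using nn by (intro add_mono mult_right_mono) auto
    also have "\<dots> \<le> frank_form P \<Omega> K1 K2 K3 n lam v v"
      unfolding D_def C_def by (rule frank_form_equal_constants_ge[OF K(3) lam])
    finally show ?thesis .
  qed
  with pos show ?thesis by blast
qed

lemma norm_pullback_id: "norm (\<chi> i. k \<bullet> id (axis i 1) :: real^3) = norm (k :: real^3)"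
  by (simp add: inner_axis)

lemma norm_pullback_drop_z: "norm (\<chi> i. k \<bullet> drop_z (axis i 1) :: real^3) = norm (k :: real^2)"
  by (simp add: norm_eq_sqrt_inner inner_vec_def sum_2 sum_3 drop_z_def axis_def)

theorem lemma3p2:
  fixes K1 K2 K3 \<alpha> \<beta> \<eta> \<Lambda> :: real
  assumes "K1 > 0" and "K2 > 0" and "K3 > 0"
    and "0 < \<alpha>" and "\<alpha> \<le> 1" and "1 \<le> \<beta>" and "0 < \<eta>" and "\<eta> \<le> \<Lambda>"
    and "K2 / K3 = 1"
  shows
    "(\<forall>(\<Omega> :: (real^3) set) n lam.
        admissible_domain \<Omega> \<and>
        admissible_iterate id \<Omega> (K2 / K3) \<alpha> \<beta> \<eta> \<Lambda> n lam \<and>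
        (AE x in lebesgue_on \<Omega>. 0 \<le> lam x) \<longrightarrow>
        (\<exists>\<alpha>\<^sub>0>0. \<forall>v\<in>HDC0 id \<Omega>.
           \<alpha>\<^sub>0 * (norm_DC id \<Omega> v)\<^sup>2 \<le> frank_form id \<Omega> K1 K2 K3 n lam v v))
     \<and>
     (\<forall>(\<Omega> :: (real^2) set) n lam.
        admissible_domain \<Omega> \<and>
        admissible_iterate drop_z \<Omega> (K2 / K3) \<alpha> \<beta> \<eta> \<Lambda> n lam \<and>
        (AE x in lebesgue_on \<Omega>. 0 \<le> lam x) \<longrightarrow>
        (\<exists>\<alpha>\<^sub>0>0. \<forall>v\<in>HDC0 drop_z \<Omega>.
           \<alpha>\<^sub>0 * (norm_DC drop_z \<Omega> v)\<^sup>2 \<le> frank_form drop_z \<Omega> K1 K2 K3 n lam v v))"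
proof (intro conjI allI impI)
  fix \<Omega> :: "(real^3) set" and n lam
  assume "admissible_domain \<Omega> \<and> admissible_iterate id \<Omega> (K2 / K3) \<alpha> \<beta> \<eta> \<Lambda> n lam \<and>
    (AE x in lebesgue_on \<Omega>. 0 \<le> lam x)"
  then show "\<exists>\<alpha>\<^sub>0>0. \<forall>v\<in>HDC0 id \<Omega>.
      \<alpha>\<^sub>0 * (norm_DC id \<Omega> v)\<^sup>2 \<le> frank_form id \<Omega> K1 K2 K3 n lam v v"
    using assms norm_pullback_id by (intro frank_form_coercive) (auto simp: admissible_domain_def)
next
  fix \<Omega> :: "(real^2) set" and n lam
  assume "admissible_domain \<Omega> \<and> admissible_iterate drop_z \<Omega> (K2 / K3) \<alpha> \<beta> \<eta> \<Lambda> n lam \<and>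
    (AE x in lebesgue_on \<Omega>. 0 \<le> lam x)"
  then show "\<exists>\<alpha>\<^sub>0>0. \<forall>v\<in>HDC0 drop_z \<Omega>.
      \<alpha>\<^sub>0 * (norm_DC drop_z \<Omega> v)\<^sup>2 \<le> frank_form drop_z \<Omega> K1 K2 K3 n lam v v"
    using assms norm_pullback_drop_z by (intro frank_form_coercive) (auto simp: admissible_domain_def)
qed

end
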